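(* Let $X$ be a subshift generated by a primitive and recognizable directive sequence $\boldsymbol\tau = (\tau_n \colon \mathcal A_{n+1}^* \to \mathcal A_n^* )_{n\geq0}$. Assume that $\boldsymbol\tau$ is decisive, or that the sequence $(|\mathcal A_n| : n \ge 0)$ is bounded. Then a real number $\alpha$ is an eigenvalue of $X$ if and only if there exist letter-coboundaries $c_n \colon \mathcal A_n^* \to \mathbb R$ in $X_{\boldsymbol\tau}^{(n)}$, for each $n \ge 0$, such that $$\sup \big\{ \| c_n(u) - \alpha\, h_n(u) \| : u \in \mathcal L(X_{\boldsymbol\tau}^{(n)}) \big\}$$ converges to $0$ as $n \to \infty$.
   Context: Alphabets are finite sets with at least two elements. $\mathcal A^*$ is the free monoid of finite words over $\mathcal A$ and $|w|$ is the length of $w$. $S$ is the shift map $S((x_k)_k)=(x_{k+1})_k$ on $\mathcal A^{\mathbb Z}$; a subshift is a closed set $X\subseteq\mathcal A^{\mathbb Z}$ with $S(X)=X$; $\mathcal L(X)$ is the set of finite words occurring in points of $X$. A substitution $\tau:\mathcal A^*\to\mathcal B^*$ is a monoid morphism such that $\tau(a)$ is non-empty for every $a\in\mathcal A$ and every $b\in\mathcal B$ occurs in some $\tau(a)$; it acts on $x\in\mathcal A^{\mathbb Z}$ by concatenation, with $\tau(x_0)$ starting at coordinate $0$. A directive sequence $\boldsymbol\tau=(\tau_n)_{n\ge0}$ consists of substitutions $\tau_n:\mathcal A_{n+1}^*\to\mathcal A_n^*$. Put $\tau_{n,m}=\tau_n\circ\cdots\circ\tau_{m-1}$ for $m>n$.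 $X^{(n)}_{\boldsymbol\tau}$ is the set of $x\in\mathcal A_n^{\mathbb Z}$ such that every finite factor of $x$ occurs in $\tau_{n,m}(a)$ for some $m>n$ and $a\in\mathcal A_m$; $X_{\boldsymbol\tau}=X^{(0)}_{\boldsymbol\tau}$; $\boldsymbol\tau$ generates $X$ if $X=X_{\boldsymbol\tau}$. Heights: $h_n(u)=|\tau_{0,n}(u)|$ for $u\in\mathcal A_n^*$, $n\ge1$, and $h_0(u)=|u|$. $\boldsymbol\tau$ is primitive if for every $n$ there is $m>n$ such that every letter of $\mathcal A_n$ occurs in $\tau_{n,m}(a)$ for every $a\in\mathcal A_m$. It is recognizable if, for every $n\ge1$, the sets $S^kB_n(a)$ ($a\in\mathcal A_n$, $0\le k<h_n(a)$) are pairwise disjoint, where $B_n(a)=\{\tau_{0,n}(x):x\in X^{(n)}_{\boldsymbol\tau},\ x_0=a\}$. It is everywhere growing if $\min_{a\in\mathcal A_n}|\tau_{0,n}(a)|\to\infty$ as $n\to\infty$. An everywhere growing $\boldsymbol\tau$ is decisive if for every $n\ge0$ there exist maps $\ell,r:\mathcal A_{n+1}\to\mathcal A_n$ such that, for all letters $a,b$ with $ab\in\mathcal L(X^{(n+1)}_{\boldsymbol\tau})$, the word $\tau_n(b)$ begins with $r(a)$ and $\tau_n(a)$ ends with $\ell(b)$. A return word to a letter $a$ in a subshift $Y\subseteq\mathcal A^{\mathbb Z}$ is a word $w$ such that $wa\in\mathcal L(Y)$ and $wa$ contains exactly two occurrences of $a$, one as a prefix and one as a suffix. A letter-coboundary in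 $Y$ is a monoid morphism $c:\mathcal A^*\to(\mathbb R,+)$ such that $c(w)=0$ for every $a\in\mathcal A$ and every return word $w$ to $a$ in $Y$. A real number $\alpha$ is an eigenvalue (meaning continuous additive eigenvalue) of $X$ if there is a continuous $g:X\to\mathbb R/\mathbb Z$ with $g(Sx)=g(x)+\alpha \pmod{\mathbb Z}$ for all $x\in X$. For $x\in\mathbb R$, $\|x\|$ is the distance from $x$ to the nearest integer. *)

theory Defs
  imports "HOL-Analysis.Analysis" "HOL-Library.Sublist" "HOL-Library.Disjoint_Sets"
begin

quotient_type circle = real / "\<lambda>x y :: real. x - y \<in> \<int>"
  morphisms rep_circle to_circle
proof (rule equivpI)
  show "reflp (\<lambda>x y :: real. x - y \<in> \<int>)"
    by (simp add: reflp_def)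
  show "symp (\<lambda>x y :: real. x - y \<in> \<int>)"
    by (metis (mono_tags, lifting) Ints_minus minus_diff_eq sympI)
  show "transp (\<lambda>x y :: real. x - y \<in> \<int>)"
  proof (rule transpI)
    fix x y z :: real
    assume "x - y \<in> \<int>" "y - z \<in> \<int>"
    then have "(x - y) + (y - z) \<in> \<int>" by (rule Ints_add)
    then show "x - z \<in> \<int>" by simp
  qed
qed

instantiation circle :: ab_group_add
begin

lift_definition zero_circle :: circle is "0 :: real" .

lift_definition plus_circle :: "circle \<Rightarrow> circle \<Rightarrow> circle" is "(+) :: real \<Rightarrow> real \<Rightarrow> real"
proof -
  fix a b c d :: real
  assume "a - b \<in> \<int>" "c - d \<in> \<int>"
  then have "(a - b) + (c - d) \<in> \<int>" by (rule Ints_add)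
  then show "(a + c) - (b + d) \<in> \<int>" by (simp add: algebra_simps)
qed

lift_definition uminus_circle :: "circle \<Rightarrow> circle" is "uminus :: real \<Rightarrow> real"
proof -
  fix a b :: real
  assume "a - b \<in> \<int>"
  then have "- (a - b) \<in> \<int>" by (rule Ints_minus)
  then show "- a - - b \<in> \<int>" by simp
qed

definition minus_circle :: "circle \<Rightarrow> circle \<Rightarrow> circle" where
  "minus_circle x y = x + - y"

instance
proof
  fix a b c :: circle
  show "a + b + c = a + (b + c)" by transfer (simp add: algebra_simps)
  show "a + b = b + a" by transfer (simp add: algebra_simps)
  show "0 + a = a" by transfer simp
  show "- a + a = 0" by transfer simp
  show "a - b = a + - b" by (rule minus_circle_def)
qed

end

instantiation circle :: topological_space
begin

definition open_circle :: "circle set \<Rightarrow> bool" where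
  "open_circle U \<longleftrightarrow> open (to_circle -` U)"

instance
proof
  show "open (UNIV :: circle set)" by (simp add: open_circle_def)
next
  fix S T :: "circle set"
  assume "open S" "open T"
  then show "open (S \<inter> T)" by (simp add: open_circle_def vimage_Int open_Int)
next
  fix K :: "circle set set"
  assume "\<forall>S\<in>K. open S"
  then show "open (\<Union>K)" by (auto simp: open_circle_def vimage_Union)
qed

end

definition dist_nearest_int :: "real \<Rightarrow> real" where
  "dist_nearest_int x = \<bar>x - of_int (round x)\<bar>"

definition alphabet :: "'a set \<Rightarrow> bool" where
  "alphabet A \<longleftrightarrow> finite A \<and> card A \<ge> 2"

definition full_shift :: "'a set \<Rightarrow> (int \<Rightarrow> 'a) topology" where
  "full_shift A = product_topology (\<lambda>_. discrete_topology A) UNIV"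

definition shift :: "(int \<Rightarrow> 'a) \<Rightarrow> int \<Rightarrow> 'a" where
  "shift x = (\<lambda>k. x (k + 1))"

definition subshift :: "'a set \<Rightarrow> (int \<Rightarrow> 'a) set \<Rightarrow> bool" where
  "subshift A X \<longleftrightarrow> closedin (full_shift A) X \<and> shift ` X = X"

definition factors :: "(int \<Rightarrow> 'a) \<Rightarrow> 'a list set" where
  "factors x = {map x [i..j] | i j. True}"

definition language :: "(int \<Rightarrow> 'a) set \<Rightarrow> 'a list set" where
  "language X = (\<Union>x\<in>X. factors x)"

definition eigenvalue :: "'a set \<Rightarrow> (int \<Rightarrow> 'a) set \<Rightarrow> real \<Rightarrow> bool" where
  "eigenvalue A X \<alpha> \<longleftrightarrow>
    (\<exists>g :: (int \<Rightarrow> 'a) \<Rightarrow> circle.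
       continuous_map (subtopology (full_shift A) X) euclidean g \<and>
       (\<forall>x\<in>X. g (shift x) = g x + to_circle \<alpha>))"

definition return_word :: "(int \<Rightarrow> 'a) set \<Rightarrow> 'a \<Rightarrow> 'a list \<Rightarrow> bool" where
  "return_word Y a w \<longleftrightarrow>
    w @ [a] \<in> language Y \<and> count_list (w @ [a]) a = 2 \<and>
    prefix [a] (w @ [a]) \<and> suffix [a] (w @ [a])"

definition letter_coboundary ::
    "'a set \<Rightarrow> (int \<Rightarrow> 'a) set \<Rightarrow> ('a list \<Rightarrow> real) \<Rightarrow> bool" where
  "letter_coboundary A Y c \<longleftrightarrow>
    c [] = 0 \<and> (\<forall>u\<in>lists A. \<forall>v\<in>lists A. c (u @ v) = c u + c v) \<and>
    (\<forall>a\<in>A. \<forall>w. return_word Y a w \<longrightarrow> c w = 0)"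

definition substitution :: "'a set \<Rightarrow> 'b set \<Rightarrow> ('a list \<Rightarrow> 'b list) \<Rightarrow> bool" where
  "substitution A B \<sigma> \<longleftrightarrow>
    \<sigma> ` lists A \<subseteq> lists B \<and>
    \<sigma> [] = [] \<and> (\<forall>u\<in>lists A. \<forall>v\<in>lists A. \<sigma> (u @ v) = \<sigma> u @ \<sigma> v) \<and>
    (\<forall>a\<in>A. \<sigma> [a] \<noteq> []) \<and>
    (\<forall>b\<in>B. \<exists>a\<in>A. b \<in> set (\<sigma> [a]))"

text \<open>
  The image \<open>\<dots>\<sigma>(x\<^sub>-\<^sub>1).\<sigma>(x\<^sub>0)\<sigma>(x\<^sub>1)\<dots>\<close>, with \<open>\<sigma>(x\<^sub>0)\<close> starting at coordinate 0.
  As \<open>\<sigma>\<close> is non-erasing, coordinate \<open>i \<ge> 0\<close> lies in \<open>\<sigma>(x\<^sub>0\<dots>x\<^sub>i)\<close>, and coordinate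
  \<open>i < 0\<close> lies in \<open>\<sigma>(x\<^sub>i\<dots>x\<^sub>-\<^sub>1)\<close>, whose last letter has coordinate \<open>-1\<close>.
\<close>

definition apply_bi :: "('a list \<Rightarrow> 'b list) \<Rightarrow> (int \<Rightarrow> 'a) \<Rightarrow> int \<Rightarrow> 'b" where
  "apply_bi \<sigma> x = (\<lambda>i.
     if 0 \<le> i then \<sigma> (map x [0..i]) ! nat i
     else (let w = \<sigma> (map x [i..-1]) in w ! nat (int (length w) + i)))"

definition directive_sequence ::
    "(nat \<Rightarrow> 'a set) \<Rightarrow> (nat \<Rightarrow> 'a list \<Rightarrow> 'a list) \<Rightarrow> bool" where
  "directive_sequence A \<tau> \<longleftrightarrow>
    (\<forall>n. alphabet (A n)) \<and> (\<forall>n. substitution (A (Suc n)) (A n) (\<tau> n))"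

text \<open>\<open>subst_comp \<tau> n m = \<tau> n \<circ> \<dots> \<circ> \<tau> (m - 1)\<close>, which is the identity for \<open>m = n\<close>;
  in particular \<open>height \<tau> 0\<close> below is the length.\<close>

definition subst_comp :: "(nat \<Rightarrow> 'a list \<Rightarrow> 'a list) \<Rightarrow> nat \<Rightarrow> nat \<Rightarrow> 'a list \<Rightarrow> 'a list" where
  "subst_comp \<tau> n m = foldr (\<lambda>k f. \<tau> k \<circ> f) [n..<m] id"

definition height :: "(nat \<Rightarrow> 'a list \<Rightarrow> 'a list) \<Rightarrow> nat \<Rightarrow> 'a list \<Rightarrow> nat" where
  "height \<tau> n u = length (subst_comp \<tau> 0 n u)"

definition level_subshift ::
    "(nat \<Rightarrow> 'a set) \<Rightarrow> (nat \<Rightarrow> 'a list \<Rightarrow> 'a list) \<Rightarrow> nat \<Rightarrow> (int \<Rightarrow> 'a) set" where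
  "level_subshift A \<tau> n =
    {x. range x \<subseteq> A n \<and>
        (\<forall>w\<in>factors x. \<exists>m>n. \<exists>a\<in>A m. sublist w (subst_comp \<tau> n m [a]))}"

definition generates ::
    "(nat \<Rightarrow> 'a set) \<Rightarrow> (nat \<Rightarrow> 'a list \<Rightarrow> 'a list) \<Rightarrow> (int \<Rightarrow> 'a) set \<Rightarrow> bool" where
  "generates A \<tau> X \<longleftrightarrow> X = level_subshift A \<tau> 0"

definition primitive ::
    "(nat \<Rightarrow> 'a set) \<Rightarrow> (nat \<Rightarrow> 'a list \<Rightarrow> 'a list) \<Rightarrow> bool" where
  "primitive A \<tau> \<longleftrightarrow>
    (\<forall>n. \<exists>m>n. \<forall>b\<in>A n. \<forall>a\<in>A m. b \<in> set (subst_comp \<tau> n m [a]))"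

definition base ::
    "(nat \<Rightarrow> 'a set) \<Rightarrow> (nat \<Rightarrow> 'a list \<Rightarrow> 'a list) \<Rightarrow> nat \<Rightarrow> 'a \<Rightarrow> (int \<Rightarrow> 'a) set" where
  "base A \<tau> n a = {apply_bi (subst_comp \<tau> 0 n) x | x. x \<in> level_subshift A \<tau> n \<and> x 0 = a}"

definition recognizable ::
    "(nat \<Rightarrow> 'a set) \<Rightarrow> (nat \<Rightarrow> 'a list \<Rightarrow> 'a list) \<Rightarrow> bool" where
  "recognizable A \<tau> \<longleftrightarrow>
    (\<forall>n\<ge>1. disjoint_family_on (\<lambda>(a, k). (shift ^^ k) ` base A \<tau> n a)
              (SIGMA a:A n. {..<height \<tau> n [a]}))"

definition everywhere_growing ::
    "(nat \<Rightarrow> 'a set) \<Rightarrow> (nat \<Rightarrow> 'a list \<Rightarrow> 'a list) \<Rightarrow> bool" where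
  "everywhere_growing A \<tau> \<longleftrightarrow>
    filterlim (\<lambda>n. Min ((\<lambda>a. length (subst_comp \<tau> 0 n [a])) ` A n)) at_top sequentially"

definition decisive ::
    "(nat \<Rightarrow> 'a set) \<Rightarrow> (nat \<Rightarrow> 'a list \<Rightarrow> 'a list) \<Rightarrow> bool" where
  "decisive A \<tau> \<longleftrightarrow>
    everywhere_growing A \<tau> \<and>
    (\<forall>n. \<exists>l r. l ` A (Suc n) \<subseteq> A n \<and> r ` A (Suc n) \<subseteq> A n \<and>
       (\<forall>a\<in>A (Suc n). \<forall>b\<in>A (Suc n).
          [a, b] \<in> language (level_subshift A \<tau> (Suc n)) \<longrightarrow>
          prefix [r a] (\<tau> n [b]) \<and> suffix [l b] (\<tau> n [a])))"

end

theory Submission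
  imports Defs
begin

text \<open>
  Write \<open>X\<^sub>n\<close> for the subshift of level \<open>n\<close> and
  \<open>\<tau>\<^sub>0\<^sub>,\<^sub>n\<close> for the composed substitution from level \<open>n\<close> to level
  \<open>0\<close>. Primitivity over alphabets of at least two letters makes the words
  \<open>\<tau>\<^sub>0\<^sub>,\<^sub>n(a)\<close> grow uniformly (\<open>growing\<close>) and makes every
  \<open>X\<^sub>n\<close> non-empty and minimal (\<open>level_nonempty\<close>, \<open>level_minimal\<close>). By
  compactness, \<open>\<alpha>\<close> is an eigenvalue of \<open>X\<close> if and only if there is a real function
  \<open>G\<close> on \<open>X\<close> that is uniformly continuous modulo 1 and grows by \<open>\<alpha>\<close>,
  modulo 1, under the shift (\<open>eigenvalue_lift\<close>, \<open>eigenvalue_of_lift\<close>).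

  From coboundaries to the eigenvalue. By minimality such a \<open>G\<close> exists as soon as, along one orbit, close
  returns happen only after times \<open>m\<close> for which \<open>m \<alpha>\<close> is almost an integer
  (\<open>lift_of_recurrence\<close>). Every close return also occurs in a point
  \<open>\<tau>\<^sub>0\<^sub>,\<^sub>n(y)\<close> with \<open>y \<in> X\<^sub>n\<close>. If it is close enough, then
  recognizability and compactness show that it leads from some height above a letter of \<open>y\<close> to the same
  height above an equal letter (\<open>recognizability_window\<close>). The word \<open>u\<close> of \<open>y\<close>
  between the two letters is a product of return words, so \<open>c\<^sub>n(u) = 0\<close> while \<open>h\<^sub>n(u) =
  m\<close>, and \<open>m \<alpha>\<close> is almost an integer by the hypothesis on \<open>c\<^sub>n\<close>
  (\<open>recurrence_of_coboundaries\<close>).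

  From the eigenvalue to coboundaries. The lift \<open>G\<close> takes close values at any two points that agree on a
  long interval, wherever this interval lies (\<open>lift_close\<close>). Hence on the base of the tower above a
  letter \<open>b\<close> of level \<open>n\<close>, where all points begin with
  \<open>\<tau>\<^sub>0\<^sub>,\<^sub>n(b)\<close>, it is constant up to a small error
  \<open>\<epsilon>\<^sub>n\<close>. If \<open>b\<close> and \<open>b'\<close> may both follow a letter
  \<open>a\<close>, the values on the two bases are close too, because some points of these bases have
  \<open>\<tau>\<^sub>0\<^sub>,\<^sub>n(a)\<close> to the left of the origin. Let \<open>\<phi>\<close> be a function
  on letters that takes at \<open>b\<close> one value of \<open>G\<close> near the base of \<open>b\<close>, the same
  for all letters that are linked by a chain of such pairs, and put \<open>c\<^sub>n(a) = \<phi>(b) -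
  \<phi>(a)\<close> for any \<open>b\<close> that may follow \<open>a\<close>. This is well defined, sums over words
  telescope, so \<open>c\<^sub>n\<close> vanishes on return words, and along a word \<open>u\<close> the potential
  changes almost as \<open>G\<close> does, namely by \<open>\<alpha> h\<^sub>n(u)\<close>. The price is the
  oscillation of \<open>G\<close> over a chain, and this is what the alternative in the hypotheses controls. If the
  alphabets are bounded, chains have bounded length and the errors add up to a bounded multiple of
  \<open>\<epsilon>\<^sub>n\<close> (\<open>class_oscillation_bounded\<close>). If the sequence is decisive, the
  images under \<open>\<tau>\<^sub>n\<^sub>-\<^sub>1\<close> of all letters of a chain begin with the same letter, so
  that a single comparison at level \<open>n - 1\<close> suffices (\<open>class_oscillation_decisive\<close>).
\<close>

section \<open>Distance to the nearest integer\<close>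

lemma dist_nearest_int_le: "dist_nearest_int x \<le> \<bar>x - of_int m\<bar>"
  unfolding dist_nearest_int_def by (rule round_diff_minimal)

lemma dist_nearest_int_le_abs: "dist_nearest_int x \<le> \<bar>x\<bar>"
  using dist_nearest_int_le[of x 0] by simp

lemma dist_nearest_int_nonneg [simp]: "0 \<le> dist_nearest_int x"
  by (simp add: dist_nearest_int_def)

lemma dist_nearest_int_le_half: "dist_nearest_int x \<le> 1/2"
  using of_int_round_abs_le[of x] by (simp add: dist_nearest_int_def abs_minus_commute)

lemma dist_nearest_int_add: "dist_nearest_int (x + y) \<le> dist_nearest_int x + dist_nearest_int y"
  using dist_nearest_int_le[of "x + y" "round x + round y"] by (simp add: dist_nearest_int_def)

lemma dist_nearest_int_cong:
  assumes "x - y \<in> \<int>"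
  shows "dist_nearest_int x = dist_nearest_int y"
proof -
  from assms obtain m where m: "x = y + of_int m"
    by (metis Ints_cases add.commute diff_add_cancel)
  have "dist_nearest_int x \<le> \<bar>x - of_int (round y + m)\<bar>" "dist_nearest_int y \<le> \<bar>y - of_int (round x - m)\<bar>"
    by (rule dist_nearest_int_le)+
  then show ?thesis by (simp add: dist_nearest_int_def m)
qed

lemma dist_nearest_int_minus [simp]: "dist_nearest_int (- x) = dist_nearest_int x"
  using dist_nearest_int_le[of x "- round (- x)"] dist_nearest_int_le[of "- x" "- round x"]
  by (simp add: dist_nearest_int_def)

lemma dist_nearest_int_commute: "dist_nearest_int (x - y) = dist_nearest_int (y - x)"
  using dist_nearest_int_minus[of "x - y"] by simp

lemma dist_nearest_int_triangle:
  "dist_nearest_int (x - z) \<le> dist_nearest_int (x - y) + dist_nearest_int (y - z)"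
  using dist_nearest_int_add[of "x - y" "y - z"] by simp

lemma Ints_if_dist_nearest_int_small:
  assumes "\<And>\<epsilon>. \<epsilon> > 0 \<Longrightarrow> dist_nearest_int x \<le> \<epsilon>"
  shows "x \<in> \<int>"
proof -
  have "dist_nearest_int x \<le> 0"
    using assms by (rule field_le_epsilon[where y = 0, simplified])
  then have "x = of_int (round x)" by (simp add: dist_nearest_int_def)
  then show ?thesis by (metis Ints_of_int)
qed

section \<open>Translates and windows of bi-infinite sequences\<close>

definition translate :: "int \<Rightarrow> (int \<Rightarrow> 'a) \<Rightarrow> int \<Rightarrow> 'a" where
  "translate i x = (\<lambda>k. x (k + i))"

definition agree_upto :: "nat \<Rightarrow> (int \<Rightarrow> 'a) \<Rightarrow> (int \<Rightarrow> 'a) \<Rightarrow> bool" where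
  "agree_upto N x y \<longleftrightarrow> (\<forall>i. \<bar>i\<bar> \<le> int N \<longrightarrow> x i = y i)"

lemma translate_apply: "translate i x k = x (k + i)"
  by (simp add: translate_def)

lemma translate_translate [simp]: "translate i (translate j x) = translate (i + j) x"
  by (simp add: translate_def ac_simps)

lemma translate_0 [simp]: "translate 0 x = x"
  by (simp add: translate_def)

lemma shift_eq_translate: "shift = translate 1"
  by (simp add: fun_eq_iff shift_def translate_apply)

lemma funpow_shift_eq_translate: "(shift ^^ k) x = translate (int k) x"
  by (induction k) (simp_all add: shift_eq_translate)

lemma map_translate_upto: "map (translate i x) [p..q] = map x [p + i..q + i]"
  by (rule nth_equalityI) (auto simp: translate_apply ac_simps)

lemma agree_upto_refl [simp]: "agree_upto N x x"
  by (simp add: agree_upto_def)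

lemma agree_upto_sym: "agree_upto N x y \<Longrightarrow> agree_upto N y x"
  by (simp add: agree_upto_def)

lemma agree_upto_trans: "agree_upto N x y \<Longrightarrow> agree_upto N y z \<Longrightarrow> agree_upto N x z"
  by (simp add: agree_upto_def)

lemma agree_upto_mono: "agree_upto N x y \<Longrightarrow> M \<le> N \<Longrightarrow> agree_upto M x y"
  by (simp add: agree_upto_def)

text \<open>
  Sequential compactness of the shift space: a window carries only finitely many patterns, so that one of them occurs
  for infinitely many indices, and the sets of indices for growing windows can be chosen nested.
\<close>

lemma cluster_point:
  fixes f :: "nat \<Rightarrow> int \<Rightarrow> 'b"
  assumes "finite B" and fB: "\<And>M i. f M i \<in> B"
  obtains z where "\<And>N. infinite {M. agree_upto N (f M) z}"
proof -
  define P where "P N I \<longleftrightarrow> infinite I \<and> (\<forall>M\<in>I. \<forall>M'\<in>I. agree_upto N (f M) (f M'))" for N I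
  have refine: "\<exists>J. P N J \<and> J \<subseteq> I" if "infinite I" for I N
  proof -
    let ?r = "\<lambda>M. restrict (f M) {- int N..int N}"
    have "?r ` I \<subseteq> {- int N..int N} \<rightarrow>\<^sub>E B" using fB by auto
    then have "finite (?r ` I)"
      by (rule finite_subset) (intro finite_PiE finite_atLeastAtMost_int assms)
    from pigeonhole_infinite[OF that this] obtain M0
      where inf: "infinite {M \<in> I. ?r M = ?r M0}" by blast
    have "agree_upto N (f M) (f M')" if "?r M = ?r M0" "?r M' = ?r M0" for M M'
    proof -
      have eq: "?r M = ?r M'" using that by simp
      show ?thesis
        unfolding agree_upto_def
      proof (intro allI impI)
        fix i assume "\<bar>i\<bar> \<le> int N"
        then have "i \<in> {- int N..int N}" by auto
        then show "f M i = f M' i" using fun_cong[OF eq, of i] by simp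
      qed
    qed
    with inf have "P N {M \<in> I. ?r M = ?r M0}" unfolding P_def by blast
    then show ?thesis by blast
  qed
  have "\<exists>I. \<forall>N. P N (I N) \<and> I (Suc N) \<subseteq> I N"
  proof (rule dependent_nat_choice)
    show "\<exists>J. P 0 J" using refine[of UNIV 0] by auto
    show "\<exists>J. P (Suc N) J \<and> J \<subseteq> I" if "P N I" for I N
      using that refine by (auto simp: P_def)
  qed
  then obtain I where I: "\<And>N. P N (I N)" and sub: "\<And>N. I (Suc N) \<subseteq> I N" by blast
  have anti: "I N \<subseteq> I N'" if "N' \<le> N" for N N' by (rule lift_Suc_antimono_le[of I, OF sub that])
  define z where "z i = f (SOME M. M \<in> I (nat \<bar>i\<bar>)) i" for i
  have "I N \<subseteq> {M. agree_upto N (f M) z}" for N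
  proof (clarsimp simp: agree_upto_def)
    fix M i assume M: "M \<in> I N" and i: "\<bar>i\<bar> \<le> int N"
    have "I (nat \<bar>i\<bar>) \<noteq> {}" using I[of "nat \<bar>i\<bar>"] by (auto simp: P_def)
    then have "(SOME M. M \<in> I (nat \<bar>i\<bar>)) \<in> I (nat \<bar>i\<bar>)" by (simp add: some_in_eq)
    moreover have "nat \<bar>i\<bar> \<le> N" using i by linarith
    then have "M \<in> I (nat \<bar>i\<bar>)" using anti M by blast
    ultimately have "agree_upto (nat \<bar>i\<bar>) (f M) (f (SOME M. M \<in> I (nat \<bar>i\<bar>)))"
      using I[of "nat \<bar>i\<bar>"] unfolding P_def by blast
    then show "f M i = z i" by (simp add: agree_upto_def z_def)
  qed
  then have "infinite {M. agree_upto N (f M) z}" for N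
    using I[of N] infinite_super[of "I N"] unfolding P_def by simp
  then show ?thesis by (rule that)
qed

section \<open>Eigenvalues through real lifts\<close>

lemma topspace_full_shift: "topspace (full_shift A) = {x. range x \<subseteq> A}"
  by (auto simp: full_shift_def PiE_def Pi_def)

text \<open>
  The sets of all sequences that agree with a given one on a window form a neighbourhood base of it. The next two
  lemmas are the two halves of this fact.
\<close>

lemma openin_full_shift_window:
  assumes "range x \<subseteq> A"
  shows "openin (full_shift A) {y. range y \<subseteq> A \<and> agree_upto N x y}"
proof -
  let ?U = "\<lambda>i. if \<bar>i\<bar> \<le> int N then {x i} else A"
  have fin: "finite {i. \<bar>i\<bar> \<le> int N}"
    by (rule finite_subset[of _ "{- int N..int N}"]) auto
  have "{y. range y \<subseteq> A \<and> agree_upto N x y} = Pi\<^sub>E UNIV ?U"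
  proof (intro equalityI subsetI)
    fix y assume "y \<in> Pi\<^sub>E UNIV ?U"
    then have y: "y i \<in> ?U i" for i by (rule PiE_mem) simp
    have "y i \<in> A" "\<bar>i\<bar> \<le> int N \<Longrightarrow> x i = y i" for i
      using y[of i] assms by (auto split: if_splits)
    then show "y \<in> {y. range y \<subseteq> A \<and> agree_upto N x y}" by (auto simp: agree_upto_def)
  qed (auto simp: agree_upto_def)
  moreover have "openin (full_shift A) (Pi\<^sub>E UNIV ?U)"
    unfolding full_shift_def
    using assms by (intro product_topology_basis) (auto intro: finite_subset[OF _ fin])
  ultimately show ?thesis by simp
qed

lemma openin_full_shiftD:
  assumes "openin (full_shift A) U" "x \<in> U"
  obtains N where "\<And>y. range y \<subseteq> A \<Longrightarrow> agree_upto N x y \<Longrightarrow> y \<in> U"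
proof -
  from assms obtain V where fin: "finite {i. V i \<noteq> A}" and xV: "x \<in> Pi\<^sub>E UNIV V"
    and sub: "Pi\<^sub>E UNIV V \<subseteq> U"
    unfolding full_shift_def openin_product_topology_alt by (auto simp: topspace_discrete_topology) 
  from fin obtain N where N: "\<And>i. V i \<noteq> A \<Longrightarrow> nat \<bar>i\<bar> \<le> N"
    using finite_nat_set_iff_bounded_le[of "(\<lambda>i. nat \<bar>i\<bar>) ` {i. V i \<noteq> A}"] by auto
  show ?thesis
  proof (rule that[of N])
    fix y assume y: "range y \<subseteq> A" "agree_upto N x y"
    have "y i \<in> V i" for i
    proof (cases "V i = A")
      case False
      then have "x i = y i" using N[of i] y(2) by (auto simp: agree_upto_def)
      then show ?thesis using xV by (metis PiE_mem UNIV_I)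
    qed (use y(1) in auto)
    then show "y \<in> U" using sub by (auto simp: PiE_def Pi_def)
  qed
qed

lemma closedin_full_shift_cluster:
  assumes "closedin (full_shift A) X" "range z \<subseteq> A" "\<And>N. \<exists>x\<in>X. agree_upto N z x"
  shows "z \<in> X"
proof (rule ccontr)
  assume "z \<notin> X"
  then have "z \<in> topspace (full_shift A) - X" using assms(2) by (simp add: topspace_full_shift)
  moreover have "openin (full_shift A) (topspace (full_shift A) - X)"
    using assms(1) by blast
  ultimately obtain N
    where "\<And>y. range y \<subseteq> A \<Longrightarrow> agree_upto N z y \<Longrightarrow> y \<in> topspace (full_shift A) - X"
    using openin_full_shiftD by metis
  with assms(3)[of N] closedin_subset[OF assms(1)] show False
    by (fastforce simp: topspace_full_shift)
qed

lemma to_circle_eq_iff: "to_circle s = to_circle t \<longleftrightarrow> s - t \<in> \<int>"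
  using circle.abs_eq_iff by simp

lemma to_circle_rep_circle [simp]: "to_circle (rep_circle t) = t"
  using Quotient_circle Quotient_abs_rep by fastforce

lemma to_circle_add: "to_circle (s + t) = to_circle s + to_circle t"
  by (simp add: plus_circle.abs_eq)

lemma open_circle_ball: "open (to_circle ` {t. dist_nearest_int (s - t) < \<epsilon>})"
proof -
  have "to_circle -` to_circle ` {t. dist_nearest_int (s - t) < \<epsilon>} = {t. dist_nearest_int (s - t) < \<epsilon>}"
  proof (auto simp: to_circle_eq_iff)
    fix t u :: real assume "u - t \<in> \<int>" "dist_nearest_int (s - t) < \<epsilon>"
    then show "dist_nearest_int (s - u) < \<epsilon>"
      using dist_nearest_int_cong[of "s - t" "s - u"] by simp
  qed
  moreover have "open {t. dist_nearest_int (s - t) < \<epsilon>}"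
    unfolding open_dist
  proof (intro ballI)
    fix t assume t: "t \<in> {t. dist_nearest_int (s - t) < \<epsilon>}"
    have "dist_nearest_int (s - u) < \<epsilon>" if "dist u t < \<epsilon> - dist_nearest_int (s - t)" for u
      using that dist_nearest_int_triangle[of s u t] dist_nearest_int_le_abs[of "t - u"]
      by (simp add: dist_real_def)
    then show "\<exists>e>0. \<forall>u. dist u t < e \<longrightarrow> u \<in> {t. dist_nearest_int (s - t) < \<epsilon>}"
      using t by (intro exI[of _ "\<epsilon> - dist_nearest_int (s - t)"]) auto
  qed
  ultimately show ?thesis by (simp add: open_circle_def)
qed

text \<open>
  Continuity on a compact space is uniform continuity, and for sequences over a finite alphabet uniform continuity
  speaks of windows. This replaces circle-valued continuous functions by arbitrary real-valued ones that are
  controlled modulo the integers.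
\<close>

definition uniform_mod_1 :: "(int \<Rightarrow> 'a) set \<Rightarrow> ((int \<Rightarrow> 'a) \<Rightarrow> real) \<Rightarrow> bool" where
  "uniform_mod_1 X G \<longleftrightarrow>
    (\<forall>\<epsilon>>0. \<exists>N. \<forall>x\<in>X. \<forall>y\<in>X. agree_upto N x y \<longrightarrow> dist_nearest_int (G x - G y) < \<epsilon>)"

lemma eigenvalue_lift:
  assumes A: "finite A" and X: "closedin (full_shift A) X" and "eigenvalue A X \<alpha>"
  obtains G where "\<And>x. x \<in> X \<Longrightarrow> G (shift x) - G x - \<alpha> \<in> \<int>" "uniform_mod_1 X G"
proof -
  from assms obtain g where cont: "continuous_map (subtopology (full_shift A) X) euclidean g"
    and g: "\<And>x. x \<in> X \<Longrightarrow> g (shift x) = g x + to_circle \<alpha>"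
    unfolding eigenvalue_def by blast
  have XA: "range x \<subseteq> A" if "x \<in> X" for x
    using closedin_subset[OF X] that by (auto simp: topspace_full_shift)
  define G where "G x = rep_circle (g x)" for x
  have gG: "g x = to_circle (G x)" for x by (simp add: G_def)
  show ?thesis
  proof (rule that[of G])
    fix x assume "x \<in> X"
    then have "to_circle (G (shift x)) = to_circle (G x + \<alpha>)"
      using g[of x] by (simp add: gG to_circle_add)
    then show "G (shift x) - G x - \<alpha> \<in> \<int>" by (simp add: to_circle_eq_iff algebra_simps)
  next
    show "uniform_mod_1 X G"
    proof (rule ccontr)
      assume "\<not> uniform_mod_1 X G"
      then obtain \<epsilon> where "\<epsilon> > 0"
        and "\<forall>N. \<exists>x y. x \<in> X \<and> y \<in> X \<and> agree_upto N x y \<and> \<not> dist_nearest_int (G x - G y) < \<epsilon>"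
        unfolding uniform_mod_1_def by blast
      then obtain x y where xy: "\<And>N. x N \<in> X" "\<And>N. y N \<in> X" "\<And>N. agree_upto N (x N) (y N)"
        "\<And>N. \<not> dist_nearest_int (G (x N) - G (y N)) < \<epsilon>"
        by metis
      obtain z where z: "\<And>N. infinite {M. agree_upto N (x M) z}"
        using cluster_point[of A x] A XA[OF xy(1)] by blast
      have M: "\<exists>M\<ge>N. agree_upto N (x M) z" for N
        using z[of N] unfolding infinite_nat_iff_unbounded_le by blast
      \<comment> \<open>Both sequences accumulate at \<open>z\<close>, since their windows of agreement grow.\<close>
      have zA: "range z \<subseteq> A"
      proof
        fix c assume "c \<in> range z"
        then obtain i where "c = z i" by auto
        moreover from M[of "nat \<bar>i\<bar>"] obtain M where "agree_upto (nat \<bar>i\<bar>) (x M) z" by blast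
        ultimately have "c = x M i" by (auto simp: agree_upto_def)
        then show "c \<in> A" using XA[OF xy(1)] by blast
      qed
      have "z \<in> X"
        by (rule closedin_full_shift_cluster[OF X zA]) (meson M xy(1) agree_upto_sym)
      let ?W = "to_circle ` {t. dist_nearest_int (G z - t) < \<epsilon> / 2}"
      have "openin (subtopology (full_shift A) X) {x \<in> topspace (subtopology (full_shift A) X). g x \<in> ?W}"
        by (rule openin_continuous_map_preimage[OF cont open_openin[THEN iffD1, OF open_circle_ball]])
      then obtain U where U: "openin (full_shift A) U"
        and eq: "{x \<in> topspace (subtopology (full_shift A) X). g x \<in> ?W} = U \<inter> X"
        unfolding openin_subtopology by blast
      have "g z \<in> ?W"
        unfolding gG by (rule imageI) (use \<open>\<epsilon> > 0\<close> in \<open>simp add: dist_nearest_int_def\<close>)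
      then have "z \<in> U"
        using \<open>z \<in> X\<close> zA eq by (auto simp: topspace_full_shift)
      then obtain N where N: "\<And>u. range u \<subseteq> A \<Longrightarrow> agree_upto N z u \<Longrightarrow> u \<in> U"
        using openin_full_shiftD[OF U] by metis
      have close: "dist_nearest_int (G z - G u) < \<epsilon> / 2" if "u \<in> X" "agree_upto N z u" for u
      proof -
        have "u \<in> U \<inter> X" using N XA that by blast
        then have "g u \<in> ?W" using eq by blast
        then obtain t where "G u - t \<in> \<int>" "dist_nearest_int (G z - t) < \<epsilon> / 2"
          by (auto simp: gG to_circle_eq_iff)
        then show ?thesis
          using dist_nearest_int_cong[of "G z - t" "G z - G u"] by simp
      qed
      from M[of N] obtain M where M: "M \<ge> N" "agree_upto N (x M) z" by blast
      then have "agree_upto N z (x M)" "agree_upto N z (y M)"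
        using agree_upto_mono[OF xy(3) M(1)] agree_upto_sym agree_upto_trans by metis+
      with close xy(1,2) have "dist_nearest_int (G z - G (x M)) < \<epsilon> / 2"
        "dist_nearest_int (G z - G (y M)) < \<epsilon> / 2" by auto
      then have "dist_nearest_int (G (x M) - G (y M)) < \<epsilon>"
        using dist_nearest_int_triangle[of "G (x M)" "G (y M)" "G z"]
          dist_nearest_int_commute[of "G (x M)" "G z"] by linarith
      with xy(4) show False by blast
    qed
  qed
qed

lemma eigenvalue_of_lift:
  assumes X: "closedin (full_shift A) X"
    and G: "\<And>x. x \<in> X \<Longrightarrow> G (shift x) - G x - \<alpha> \<in> \<int>" "uniform_mod_1 X G"
  shows "eigenvalue A X \<alpha>"
  unfolding eigenvalue_def
proof (intro exI[of _ "\<lambda>x. to_circle (G x)"] conjI ballI)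
  fix x assume "x \<in> X"
  with G(1)[of x] show "to_circle (G (shift x)) = to_circle (G x) + to_circle \<alpha>"
    by (simp add: to_circle_eq_iff algebra_simps flip: to_circle_add)
next
  have XA: "range x \<subseteq> A" if "x \<in> X" for x
    using closedin_subset[OF X] that by (auto simp: topspace_full_shift)
  show "continuous_map (subtopology (full_shift A) X) euclidean (\<lambda>x. to_circle (G x))"
    unfolding continuous_map_def
  proof (intro conjI allI impI)
    show "(\<lambda>x. to_circle (G x)) \<in> topspace (subtopology (full_shift A) X) \<rightarrow> topspace euclidean"
      by simp
  next
    fix U :: "circle set" assume "openin euclidean U"
    then have "open U" by (rule open_openin[THEN iffD2])
    then have U: "open (to_circle -` U)" by (simp add: open_circle_def)
    let ?V = "{x \<in> topspace (subtopology (full_shift A) X). to_circle (G x) \<in> U}"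
    show "openin (subtopology (full_shift A) X) ?V"
    proof (subst openin_subopen, intro ballI)
      fix x assume "x \<in> ?V"
      then have x: "x \<in> X" "range x \<subseteq> A" "to_circle (G x) \<in> U" by (auto simp: topspace_full_shift)
      then obtain \<epsilon> where e: "\<epsilon> > 0" "\<And>t. dist t (G x) < \<epsilon> \<Longrightarrow> to_circle t \<in> U"
        using U unfolding open_dist by (metis vimageE vimageI)
      from G(2) e(1) obtain N
        where N: "\<And>y. y \<in> X \<Longrightarrow> agree_upto N x y \<Longrightarrow> dist_nearest_int (G x - G y) < \<epsilon>"
        using x(1) unfolding uniform_mod_1_def by blast
      let ?C = "{y. range y \<subseteq> A \<and> agree_upto N x y} \<inter> X"
      have "openin (subtopology (full_shift A) X) ?C"
        using openin_full_shift_window[OF x(2), of N] by (auto simp: openin_subtopology)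
      moreover have "to_circle (G y) \<in> U" if "y \<in> ?C" for y
      proof -
        have "to_circle (G y + of_int (round (G x - G y))) \<in> U"
          using N[of y] that
          by (intro e(2)) (simp add: dist_nearest_int_def dist_real_def abs_minus_commute algebra_simps)
        moreover have "to_circle (G y + of_int (round (G x - G y))) = to_circle (G y)"
          by (simp add: to_circle_eq_iff)
        ultimately show ?thesis by simp
      qed
      then have "?C \<subseteq> ?V" by (auto simp: topspace_full_shift)
      ultimately show "\<exists>T. openin (subtopology (full_shift A) X) T \<and> x \<in> T \<and> T \<subseteq> ?V"
        using x by (intro exI[of _ ?C]) auto
    qed
  qed
qed

text \<open>
  The recurrence hypothesis says that the map that sends the \<open>i\<close>-th translate of \<open>x\<close> to
  \<open>i \<alpha>\<close> is uniformly continuous modulo 1 on the orbit of \<open>x\<close>. It extends to the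
  points of \<open>X\<close>, since these are limits of the orbit.
\<close>

lemma lift_of_recurrence:
  assumes dense: "\<And>y N. y \<in> X \<Longrightarrow> \<exists>i. agree_upto N (translate i x) y"
    and recur: "\<And>\<epsilon>. \<epsilon> > 0 \<Longrightarrow> \<exists>N. \<forall>i j. agree_upto N (translate i x) (translate j x) \<longrightarrow>
                  dist_nearest_int (\<alpha> * of_int (i - j)) < \<epsilon>"
  obtains G where "\<And>y. y \<in> X \<Longrightarrow> shift y \<in> X \<Longrightarrow> G (shift y) - G y - \<alpha> \<in> \<int>" "uniform_mod_1 X G"
proof -
  define lim where "lim y t \<longleftrightarrow> (\<forall>\<epsilon>>0. \<exists>N. \<forall>i. agree_upto N (translate i x) y \<longrightarrow>
    dist_nearest_int (\<alpha> * of_int i - t) < \<epsilon>)" for y t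
  have ex: "\<exists>t. lim y t" if y: "y \<in> X" for y
  proof -
    from dense[OF y] obtain m where m: "\<And>k. agree_upto k (translate (m k) x) y" by metis
    \<comment> \<open>Fractional parts stay bounded and are therefore subject to the Bolzano-Weierstrass theorem.\<close>
    have "bounded (range (\<lambda>k. frac (\<alpha> * of_int (m k))))"
      by (rule boundedI[of _ 1]) (auto simp: abs_of_nonneg less_imp_le frac_lt_1)
    then obtain t s where s: "strict_mono s" "((\<lambda>k. frac (\<alpha> * of_int (m k))) \<circ> s) \<longlonglongrightarrow> t"
      using bounded_imp_convergent_subsequence by blast
    have "lim y t"
      unfolding lim_def
    proof (intro allI impI)
      fix \<epsilon> :: real assume "\<epsilon> > 0"
      then obtain N where N: "\<And>i j. agree_upto N (translate i x) (translate j x) \<Longrightarrow>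
          dist_nearest_int (\<alpha> * of_int (i - j)) < \<epsilon> / 2"
        using recur[of "\<epsilon> / 2"] by auto
      from LIMSEQ_D[OF s(2), of "\<epsilon> / 2"] \<open>\<epsilon> > 0\<close> obtain k0
        where k0: "\<And>k. k \<ge> k0 \<Longrightarrow> \<bar>frac (\<alpha> * of_int (m (s k))) - t\<bar> < \<epsilon> / 2"
        by auto
      define k where "k = s (max k0 N)"
      have "N \<le> k" using seq_suble[OF s(1), of "max k0 N"] by (simp add: k_def)
      have "dist_nearest_int (\<alpha> * of_int (m k) - t) = dist_nearest_int (frac (\<alpha> * of_int (m k)) - t)"
        by (rule dist_nearest_int_cong) (simp add: frac_def)
      also have "\<dots> < \<epsilon> / 2"
        using dist_nearest_int_le_abs k0[of "max k0 N"] unfolding k_def by (rule le_less_trans) simp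
      finally have close: "dist_nearest_int (\<alpha> * of_int (m k) - t) < \<epsilon> / 2" .
      have "dist_nearest_int (\<alpha> * of_int i - t) < \<epsilon>" if "agree_upto N (translate i x) y" for i
      proof -
        have "agree_upto N (translate i x) (translate (m k) x)"
          using that agree_upto_mono[OF m[of k] \<open>N \<le> k\<close>] agree_upto_sym agree_upto_trans by metis
        then have "dist_nearest_int (\<alpha> * of_int i - \<alpha> * of_int (m k)) < \<epsilon> / 2"
          using N by (simp add: algebra_simps)
        with close show ?thesis
          using dist_nearest_int_triangle[of "\<alpha> * of_int i" t "\<alpha> * of_int (m k)"] by linarith
      qed
      then show "\<exists>N. \<forall>i. agree_upto N (translate i x) y \<longrightarrow> dist_nearest_int (\<alpha> * of_int i - t) < \<epsilon>"
        by blast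
    qed
    then show ?thesis by blast
  qed
  define G where "G y = (SOME t. lim y t)" for y
  have "lim y (G y)" if "y \<in> X" for y
    unfolding G_def using ex[OF that] by (rule someI_ex)
  then have G: "\<exists>N. \<forall>i. agree_upto N (translate i x) y \<longrightarrow>
      dist_nearest_int (\<alpha> * of_int i - G y) < \<epsilon>" if "y \<in> X" "\<epsilon> > 0" for y \<epsilon>
    using that unfolding lim_def by blast
  have approx: "\<exists>i. agree_upto K (translate i x) y \<and> dist_nearest_int (\<alpha> * of_int i - G y) < \<epsilon>"
    if y: "y \<in> X" and "\<epsilon> > 0" for y K \<epsilon>
  proof -
    from G[OF that] obtain N where N: "\<And>i. agree_upto N (translate i x) y \<Longrightarrow>
      dist_nearest_int (\<alpha> * of_int i - G y) < \<epsilon>" by blast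
    from dense[OF y] obtain i where i: "agree_upto (max N K) (translate i x) y" by blast
    then have "agree_upto N (translate i x) y" "agree_upto K (translate i x) y"
      by (auto elim: agree_upto_mono)
    then show ?thesis using N by blast
  qed
  show ?thesis
  proof (rule that)
    fix y assume y: "y \<in> X" "shift y \<in> X"
    show "G (shift y) - G y - \<alpha> \<in> \<int>"
    proof (rule Ints_if_dist_nearest_int_small)
      fix \<epsilon> :: real assume "\<epsilon> > 0"
      then have "\<epsilon> / 2 > 0" by simp
      from G[OF y(2) this] obtain N where N: "\<And>i. agree_upto N (translate i x) (shift y) \<Longrightarrow>
        dist_nearest_int (\<alpha> * of_int i - G (shift y)) < \<epsilon> / 2" by blast
      from approx[OF y(1) \<open>\<epsilon> / 2 > 0\<close>, of "N + 1"] obtain i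
        where i: "agree_upto (N + 1) (translate i x) y" "dist_nearest_int (\<alpha> * of_int i - G y) < \<epsilon> / 2"
        by blast
      have "agree_upto N (translate (i + 1) x) (shift y)"
        unfolding agree_upto_def shift_def translate_apply
      proof (intro allI impI)
        fix k assume "\<bar>k\<bar> \<le> int N"
        then have "translate i x (k + 1) = y (k + 1)" using i(1) by (simp add: agree_upto_def)
        then show "x (k + (i + 1)) = y (k + 1)" by (simp add: translate_apply ac_simps)
      qed
      from N[OF this] have "dist_nearest_int (G (shift y) - \<alpha> * of_int (i + 1)) < \<epsilon> / 2"
        by (subst dist_nearest_int_commute)
      with i(2) show "dist_nearest_int (G (shift y) - G y - \<alpha>) \<le> \<epsilon>"
        using dist_nearest_int_add[of "G (shift y) - \<alpha> * of_int (i + 1)" "\<alpha> * of_int i - G y"]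
        by (simp add: algebra_simps)
    qed
  next
    show "uniform_mod_1 X G"
      unfolding uniform_mod_1_def
    proof (intro allI impI)
      fix \<epsilon> :: real assume "\<epsilon> > 0"
      then obtain N where N: "\<And>i j. agree_upto N (translate i x) (translate j x) \<Longrightarrow>
          dist_nearest_int (\<alpha> * of_int (i - j)) < \<epsilon> / 3"
        using recur[of "\<epsilon> / 3"] by auto
      have "dist_nearest_int (G y - G z) < \<epsilon>" if yz: "y \<in> X" "z \<in> X" "agree_upto N y z" for y z
      proof -
        have "\<epsilon> / 3 > 0" using \<open>\<epsilon> > 0\<close> by simp
        obtain i where i: "agree_upto N (translate i x) y" "dist_nearest_int (\<alpha> * of_int i - G y) < \<epsilon> / 3"
          using approx[OF yz(1) \<open>\<epsilon> / 3 > 0\<close>] by blast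
        obtain j where j: "agree_upto N (translate j x) z" "dist_nearest_int (\<alpha> * of_int j - G z) < \<epsilon> / 3"
          using approx[OF yz(2) \<open>\<epsilon> / 3 > 0\<close>] by blast
        have "agree_upto N (translate i x) (translate j x)"
          using i(1) j(1) yz(3) agree_upto_sym agree_upto_trans by metis
        then have "dist_nearest_int (\<alpha> * of_int i - \<alpha> * of_int j) < \<epsilon> / 3"
          using N by (simp add: algebra_simps)
        moreover have "dist_nearest_int (G y - \<alpha> * of_int i) < \<epsilon> / 3"
          using i(2) by (subst dist_nearest_int_commute)
        ultimately show ?thesis
          using j(2) dist_nearest_int_triangle[of "G y" "G z" "\<alpha> * of_int i"]
            dist_nearest_int_triangle[of "\<alpha> * of_int i" "G z" "\<alpha> * of_int j"] by linarith
      qed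
      then show "\<exists>N. \<forall>y\<in>X. \<forall>z\<in>X. agree_upto N y z \<longrightarrow> dist_nearest_int (G y - G z) < \<epsilon>"
        by blast
    qed
  qed
qed

section \<open>The action of a substitution on bi-infinite sequences\<close>

lemma map_upto_in_factors [simp]: "map x [i..j] \<in> factors x"
  by (auto simp: factors_def)

lemma map_upto_split:
  "i \<le> j \<Longrightarrow> j \<le> k + 1 \<Longrightarrow> map x [i..k] = map x [i..j - 1] @ map x [j..k]"
  using upto_split1[of i j k] by (cases "j = k + 1") auto

lemma sublist_map_upto:
  assumes "i' \<le> i" "j \<le> j'"
  shows "sublist (map x [i..j]) (map x [i'..j'])"
proof (cases "i \<le> j")
  case True
  then have "map x [i'..j'] = map x [i'..i - 1] @ map x [i..j] @ map x [j + 1..j']"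
    using map_upto_split[of i' i j' x] map_upto_split[of i "j + 1" j' x] assms by simp
  then show ?thesis by (auto simp: sublist_def)
qed simp

lemma factors_sublist:
  assumes "w \<in> factors x" "sublist v w"
  shows "v \<in> factors x"
proof -
  from assms obtain i j p s where eq: "map x [i..j] = p @ v @ s"
    by (auto simp: factors_def sublist_def)
  then have "length (map x [i..j]) = length (p @ v @ s)" by (rule arg_cong)
  then have len: "nat (j - i + 1) = length p + length v + length s" by simp
  have "v = map x [i + int (length p)..i + int (length p) + int (length v) - 1]"
  proof (rule nth_equalityI)
    fix k assume k: "k < length v"
    have "(p @ v @ s) ! (length p + k) = x (i + int (length p + k))"
      unfolding eq[symmetric] using k len by (subst nth_map) (auto simp: nth_upto)
    with k show "v ! k = map x [i + int (length p)..i + int (length p) + int (length v) - 1] ! k"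
      by (simp add: nth_append ac_simps)
  qed simp
  then show ?thesis by (metis map_upto_in_factors)
qed

lemma map_upto_eqD:
  assumes "map x [i..i + d] = map y [j..j + d]" "0 \<le> k" "k \<le> d"
  shows "x (i + k) = y (j + k)"
proof -
  have "map x [i..i + d] ! nat k = map y [j..j + d] ! nat k" using assms(1) by simp
  with assms(2,3) show ?thesis by simp
qed

lemma set_factors: "w \<in> factors x \<Longrightarrow> set w \<subseteq> range x"
  by (auto simp: factors_def)

lemma factors_translate [simp]: "factors (translate i x) = factors x"
proof -
  have "\<exists>p q. map x [a..b] = map x [p + i..q + i]" for a b
    by (intro exI[of _ "a - i"] exI[of _ "b - i"]) simp
  then show ?thesis
    by (auto simp: factors_def map_translate_upto)
qed

text \<open>
  Both a substitution and the compositions of substitutions of a directive sequence are instances, each on words over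
  its own alphabet only.
\<close>

locale nonerasing_morphism =
  fixes A :: "'a set" and \<sigma> :: "'a list \<Rightarrow> 'b list"
  assumes image_Nil [simp]: "\<sigma> [] = []"
    and image_append: "u \<in> lists A \<Longrightarrow> v \<in> lists A \<Longrightarrow> \<sigma> (u @ v) = \<sigma> u @ \<sigma> v"
    and nonerasing: "a \<in> A \<Longrightarrow> \<sigma> [a] \<noteq> []"
begin

lemma image_Cons: "a \<in> A \<Longrightarrow> v \<in> lists A \<Longrightarrow> \<sigma> (a # v) = \<sigma> [a] @ \<sigma> v"
  using image_append[of "[a]" v] by simp

lemma length_pos: "a \<in> A \<Longrightarrow> 0 < length (\<sigma> [a])"
  using nonerasing by simp

lemma length_le: "u \<in> lists A \<Longrightarrow> length u \<le> length (\<sigma> u)"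
proof (induction u)
  case (Cons a u)
  then have "length (\<sigma> (a # u)) = length (\<sigma> [a]) + length (\<sigma> u)" "0 < length (\<sigma> [a])"
    using image_Cons[of a u] length_pos[of a] by auto
  moreover have "length u \<le> length (\<sigma> u)" using Cons by simp
  ultimately show ?case by (simp only: list.size)
qed simp

lemma sublist_image:
  assumes "sublist u v" "v \<in> lists A"
  shows "sublist (\<sigma> u) (\<sigma> v)"
proof -
  from assms(1) obtain p s where "v = p @ u @ s" by (auto simp: sublist_def)
  with assms(2) have "\<sigma> v = \<sigma> p @ \<sigma> u @ \<sigma> s" by (simp add: image_append)
  then show ?thesis by (auto simp: sublist_def)
qed

text \<open>
  A window that is at least as long as two consecutive images must contain a whole image: its left end cuts at most
  one of them.
\<close>

lemma long_sublist_contains_image: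
  assumes "v \<in> lists A" "sublist f (\<sigma> v)" "\<And>b. b \<in> A \<Longrightarrow> length (\<sigma> [b]) \<le> H" "2 * H \<le> length f" "f \<noteq> []"
  shows "\<exists>b\<in>A. sublist (\<sigma> [b]) f"
proof -
  from assms(2) obtain p s where "\<sigma> v = p @ f @ s" by (auto simp: sublist_def)
  with assms(1) show ?thesis
  proof (induction v arbitrary: p)
    case Nil
    with assms(5) show ?case by simp
  next
    case (Cons b v)
    then have b: "b \<in> A" and v: "v \<in> lists A" by auto
    have eq: "\<sigma> [b] @ \<sigma> v = p @ f @ s" using Cons.prems image_Cons[OF b v] by simp
    show ?case
    proof (cases "length (\<sigma> [b]) \<le> length p")
      case True
      with eq obtain p' where "p = \<sigma> [b] @ p'"
        by (auto simp: append_eq_append_conv2)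
      with eq have "\<sigma> v = p' @ f @ s" by simp
      then show ?thesis using Cons.IH v by blast
    next
      case False
      with eq obtain e where e: "\<sigma> [b] = p @ e" "e @ \<sigma> v = f @ s"
        by (auto simp: append_eq_append_conv2)
      have le: "length e \<le> H" using assms(3)[OF b] e(1) by simp
      show ?thesis
      proof (cases v)
        case Nil
        then have "e = f @ s" using e(2) by simp
        then show ?thesis using le assms(4,5) by (cases f) auto
      next
        case (Cons c v')
        with v have c: "c \<in> A" and v': "v' \<in> lists A" by auto
        have "\<sigma> v = \<sigma> [c] @ \<sigma> v'" using Cons image_Cons[OF c v'] by simp
        then have "(e @ \<sigma> [c]) @ \<sigma> v' = f @ s" using e(2) by simp
        moreover have "length (e @ \<sigma> [c]) \<le> length f" using le assms(3)[OF c] assms(4) by simp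
        ultimately have "prefix (e @ \<sigma> [c]) f" by (metis prefixI prefix_length_prefix)
        then obtain t where "f = e @ \<sigma> [c] @ t" by (auto simp: prefix_def)
        then have "sublist (\<sigma> [c]) f" by simp
        then show ?thesis using c by blast
      qed
    qed
  qed
qed

text \<open>
  These are the starting points of the images of the single letters in the concatenation. They are counted from the
  origin, to the right for \<open>j \<ge> 0\<close> and to the left for \<open>j < 0\<close>.
\<close>

definition cut :: "(int \<Rightarrow> 'a) \<Rightarrow> int \<Rightarrow> int" where
  "cut y j = (if 0 \<le> j then int (length (\<sigma> (map y [0..j - 1])))
              else - int (length (\<sigma> (map y [j..-1]))))"

context
  fixes y :: "int \<Rightarrow> 'a"
  assumes y: "range y \<subseteq> A"
begin

lemma map_in_lists [simp]: "map y js \<in> lists A"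
  using y by (auto simp: subset_iff)

lemma letter_in [simp]: "y j \<in> A"
  using y by auto

lemma cut_0 [simp]: "cut y 0 = 0"
  by (simp add: cut_def)

lemma cut_Suc: "cut y (j + 1) = cut y j + int (length (\<sigma> [y j]))"
proof -
  consider "0 \<le> j" | "j = -1" | "j < -1" by linarith
  then show ?thesis
  proof cases
    case 1
    then have "map y [0..j] = map y [0..j - 1] @ [y j]"
      by (simp add: upto_rec2)
    then have "\<sigma> (map y [0..j]) = \<sigma> (map y [0..j - 1]) @ \<sigma> [y j]"
      by (simp add: image_append)
    with 1 show ?thesis by (simp add: cut_def)
  next
    case 2
    then show ?thesis by (simp add: cut_def)
  next
    case 3
    then have "map y [j..-1] = [y j] @ map y [j + 1..-1]"
      by (simp add: upto_rec1)
    then have "\<sigma> (map y [j..-1]) = \<sigma> [y j] @ \<sigma> (map y [j + 1..-1])"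
      by (metis image_append letter_in map_in_lists lists.Cons lists.Nil)
    with 3 show ?thesis by (simp add: cut_def)
  qed
qed

lemma cut_less: "cut y j < cut y (j + 1)"
  using cut_Suc[of j] length_pos[of "y j"] by simp

text \<open>Images are non-empty, so that cut positions spread at least as fast as the coordinates themselves.\<close>

lemma cut_diff_ge: "i \<le> j \<Longrightarrow> j - i \<le> cut y j - cut y i"
proof (induction j rule: int_ge_induct)
  case (step j)
  then show ?case using cut_less[of j] by simp
qed simp

lemma cut_mono: "i \<le> j \<Longrightarrow> cut y i \<le> cut y j"
  using cut_diff_ge[of i j] by simp

lemma cut_diff: "i \<le> j \<Longrightarrow> cut y j - cut y i = int (length (\<sigma> (map y [i..j - 1])))"
proof (induction j rule: int_ge_induct)
  case (step j)
  then have "map y [i..j] = map y [i..j - 1] @ [y j]" by (simp add: upto_rec2)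
  then have "\<sigma> (map y [i..j]) = \<sigma> (map y [i..j - 1]) @ \<sigma> [y j]" by (simp add: image_append)
  then show ?case using step cut_Suc[of j] by simp
qed simp

lemma obtain_cut:
  obtains j k where "i = cut y j + int k" "k < length (\<sigma> [y j])"
proof -
  \<comment> \<open>The letter above coordinate \<open>i\<close> is the last one that starts at or before \<open>i\<close>.\<close>
  define J where "J = {j. - \<bar>i\<bar> - 1 \<le> j \<and> cut y j \<le> i}"
  have bound: "j \<le> \<bar>i\<bar> + 1" if "cut y j \<le> i" for j
    using that cut_diff_ge[of 0 j] by (cases "0 \<le> j") auto
  then have "J \<subseteq> {- \<bar>i\<bar> - 1..\<bar>i\<bar> + 1}" by (auto simp: J_def)
  then have fin: "finite J" by (rule finite_subset) simp
  have "- \<bar>i\<bar> - 1 \<in> J" 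
  proof -
    have "- \<bar>i\<bar> - 1 \<le> 0" by simp
    from cut_diff_ge[OF this] have "cut y (- \<bar>i\<bar> - 1) \<le> - \<bar>i\<bar> - 1" by simp
    then show ?thesis by (simp add: J_def)
  qed
  then have max: "Max J \<in> J" using fin Max_in by blast
  have "Max J + 1 \<notin> J" using fin Max_ge[of J "Max J + 1"] by force
  then have "i < cut y (Max J + 1)" using max by (auto simp: J_def)
  moreover have "cut y (Max J) \<le> i" using max by (auto simp: J_def)
  ultimately show ?thesis
    using that[of "Max J" "nat (i - cut y (Max J))"] cut_Suc[of "Max J"] by linarith
qed

text \<open>
  The distinction of signs in the action is the one in the cut positions. Once the two have been matched here, both
  sides of the origin can be treated alike.
\<close>

lemma apply_bi_cut:
  assumes k: "k < length (\<sigma> [y j])"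
  shows "apply_bi \<sigma> y (cut y j + int k) = \<sigma> [y j] ! k"
proof (cases "0 \<le> j")
  case True
  let ?i = "cut y j + int k"
  have i: "j \<le> ?i" "0 \<le> ?i" using cut_diff_ge[of 0 j] True by auto
  have "map y [0..?i] = map y [0..j - 1] @ [y j] @ map y [j + 1..?i]"
    using True i map_upto_split[of 0 j ?i y] by (simp add: upto_rec1)
  then have "\<sigma> (map y [0..?i]) = \<sigma> (map y [0..j - 1]) @ \<sigma> [y j] @ \<sigma> (map y [j + 1..?i])"
    using image_append letter_in map_in_lists by (metis append_in_lists_conv lists.Cons lists.Nil)
  moreover have "nat ?i = length (\<sigma> (map y [0..j - 1])) + k"
    using True by (simp add: cut_def)
  ultimately show ?thesis using i k by (simp add: apply_bi_def nth_append)
next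
  case False
  define i where "i = cut y j + int k"
  have i: "i \<le> j" "i < 0"
  proof -
    have "i < cut y (j + 1)" using cut_Suc[of j] k by (simp add: i_def)
    then show "i < 0" "i \<le> j" using cut_diff_ge[of "j + 1" 0] False by auto
  qed
  let ?s = "\<sigma> (map y [j + 1..-1])"
  have s: "\<sigma> (map y [j..-1]) = \<sigma> [y j] @ ?s"
    using False image_append[of "[y j]" "map y [j + 1..-1]"] by (simp add: upto_rec1)
  have "map y [i..-1] = map y [i..j - 1] @ map y [j..-1]"
    using i False by (intro map_upto_split) auto
  then have w: "\<sigma> (map y [i..-1]) = \<sigma> (map y [i..j - 1]) @ \<sigma> [y j] @ ?s"
    by (simp add: image_append s)
  have "i = int k - int (length (\<sigma> [y j])) - int (length ?s)"
    using False s by (simp add: cut_def i_def)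
  then have "nat (int (length (\<sigma> (map y [i..-1]))) + i) = length (\<sigma> (map y [i..j - 1])) + k"
    unfolding w by simp
  then have "apply_bi \<sigma> y i = (\<sigma> (map y [i..j - 1]) @ \<sigma> [y j] @ ?s) ! (length (\<sigma> (map y [i..j - 1])) + k)"
    using i by (simp only: apply_bi_def Let_def w) simp
  also have "\<dots> = \<sigma> [y j] ! k"
    unfolding nth_append_length_plus using k by (simp add: nth_append)
  finally show ?thesis by (simp add: i_def)
qed

lemma map_apply_bi_cut:
  assumes "i \<le> j"
  shows "map (apply_bi \<sigma> y) [cut y i..cut y j - 1] = \<sigma> (map y [i..j - 1])"
  using assms
proof (induction j rule: int_ge_induct)
  case (step j)
  have "map (apply_bi \<sigma> y) [cut y j..cut y (j + 1) - 1] = \<sigma> [y j]"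
    by (rule nth_equalityI) (simp_all add: cut_Suc apply_bi_cut)
  moreover have "map y [i..j] = map y [i..j - 1] @ [y j]"
    using step.hyps by (simp add: upto_rec2)
  moreover have "map (apply_bi \<sigma> y) [cut y i..cut y (j + 1) - 1] =
      map (apply_bi \<sigma> y) [cut y i..cut y j - 1] @ map (apply_bi \<sigma> y) [cut y j..cut y (j + 1) - 1]"
    using cut_mono[OF step.hyps] cut_less[of j] by (intro map_upto_split) auto
  ultimately show ?case using step.IH image_append[of "map y [i..j - 1]" "[y j]"] by simp
qed simp

lemma factors_apply_bi:
  assumes "w \<in> factors (apply_bi \<sigma> y)"
  shows "\<exists>v\<in>factors y. sublist w (\<sigma> v)"
proof -
  from assms obtain i j where w: "w = map (apply_bi \<sigma> y) [i..j]" by (auto simp: factors_def)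
  let ?i = "- \<bar>i\<bar>" and ?j = "\<bar>j\<bar> + 1"
  have "cut y ?i \<le> i" using cut_diff_ge[of ?i 0] by simp
  moreover have "j \<le> cut y ?j - 1" using cut_diff_ge[of 0 ?j] by simp
  ultimately have "sublist w (map (apply_bi \<sigma> y) [cut y ?i..cut y ?j - 1])"
    unfolding w by (rule sublist_map_upto)
  also have "\<dots> = \<sigma> (map y [?i..?j - 1])" by (rule map_apply_bi_cut) simp
  finally show ?thesis by (rule bexI) simp
qed

lemma range_apply_bi:
  assumes "\<And>a. a \<in> A \<Longrightarrow> set (\<sigma> [a]) \<subseteq> B"
  shows "range (apply_bi \<sigma> y) \<subseteq> B"
proof
  fix b assume "b \<in> range (apply_bi \<sigma> y)"
  then obtain i where b: "b = apply_bi \<sigma> y i" by auto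
  obtain j k where "i = cut y j + int k" and k: "k < length (\<sigma> [y j])" by (rule obtain_cut)
  then have "b = \<sigma> [y j] ! k" using apply_bi_cut b by simp
  then show "b \<in> B" using assms[of "y j"] nth_mem[OF k] by auto
qed

end

lemma cut_translate:
  assumes y: "range y \<subseteq> A"
  shows "cut (translate p y) j = cut y (j + p) - cut y p"
proof -
  define z where "z = translate p y"
  have z: "z j = y (j + p)" for j by (simp add: z_def translate_apply)
  then have zA: "range z \<subseteq> A" using y by auto
  have "cut z j = cut y (j + p) - cut y p"
  proof (induction j rule: int_induct[where k = 0])
    case base
    show ?case using cut_0[OF y] cut_0[OF zA] by simp
  next
    case (step1 j)
    then show ?case using cut_Suc[OF zA, of j] cut_Suc[OF y, of "j + p"] by (simp add: z[of j] ac_simps)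
  next
    case (step2 j)
    then show ?case
      using cut_Suc[OF zA, of "j - 1"] cut_Suc[OF y, of "j - 1 + p"] by (simp add: z[of "j - 1"] algebra_simps)
  qed
  then show ?thesis by (simp add: z_def)
qed

lemma apply_bi_translate:
  assumes y: "range y \<subseteq> A"
  shows "apply_bi \<sigma> (translate p y) = translate (cut y p) (apply_bi \<sigma> y)"
proof
  fix i
  define z where "z = translate p y"
  have z: "z j = y (j + p)" for j by (simp add: z_def translate_apply)
  then have zA: "range z \<subseteq> A" using y by auto
  obtain j k where i: "i = cut z j + int k" and k: "k < length (\<sigma> [z j])"
    using obtain_cut[OF zA] .
  have "apply_bi \<sigma> z i = \<sigma> [y (j + p)] ! k"
    using apply_bi_cut[OF zA k] i by (simp add: z[of j])
  also have "\<dots> = apply_bi \<sigma> y (cut y (j + p) + int k)"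
    using apply_bi_cut[OF y, of k "j + p"] k by (simp add: z[of j])
  also have "cut y (j + p) + int k = i + cut y p"
    using i cut_translate[OF y, of p j] by (simp add: z_def)
  finally show "apply_bi \<sigma> (translate p y) i = translate (cut y p) (apply_bi \<sigma> y) i"
    unfolding z_def translate_apply[of "cut y p" "apply_bi \<sigma> y" i] .
qed

end

lemma apply_bi_local:
  assumes "agree_upto N x y" "\<bar>i\<bar> \<le> int N"
  shows "apply_bi \<sigma> x i = apply_bi \<sigma> y i"
proof -
  have eq: "map x [0..i] = map y [0..i]" "map x [i..-1] = map y [i..-1]"
    using assms by (auto simp: agree_upto_def)
  show ?thesis unfolding apply_bi_def eq ..
qed

section \<open>Primitive directive sequences\<close>

lemma sublist_singleton: "b \<in> set v \<Longrightarrow> sublist [b] v"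
  by (force simp: in_set_conv_decomp sublist_def)

lemma (in nonerasing_morphism) set_image_mono:
  assumes "b \<in> set v" "v \<in> lists A"
  shows "set (\<sigma> [b]) \<subseteq> set (\<sigma> v)"
proof -
  from assms(1) have "sublist [b] v" by (rule sublist_singleton)
  then show ?thesis using sublist_image[OF _ assms(2)] set_mono_sublist by blast
qed

lemma nonerasing_morphism_of_substitution:
  "substitution A B \<sigma> \<Longrightarrow> nonerasing_morphism A \<sigma>"
  by unfold_locales (auto simp: substitution_def)

lemma substitution_comp:
  assumes \<sigma>: "substitution A B \<sigma>" and \<rho>: "substitution B C \<rho>"
  shows "substitution A C (\<rho> \<circ> \<sigma>)"
proof -
  interpret \<sigma>: nonerasing_morphism A \<sigma> using \<sigma> by (rule nonerasing_morphism_of_substitution)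
  interpret \<rho>: nonerasing_morphism B \<rho> using \<rho> by (rule nonerasing_morphism_of_substitution)
  have \<sigma>B: "\<sigma> u \<in> lists B" if "u \<in> lists A" for u
    using \<sigma> that unfolding substitution_def by blast
  have \<rho>C: "\<rho> u \<in> lists C" if "u \<in> lists B" for u
    using \<rho> that unfolding substitution_def by blast
  show ?thesis
    unfolding substitution_def
  proof (intro conjI ballI)
    show "(\<rho> \<circ> \<sigma>) ` lists A \<subseteq> lists C"
      unfolding image_subset_iff comp_apply using \<sigma>B \<rho>C by blast
    show "(\<rho> \<circ> \<sigma>) [] = []" by simp
  next
    fix u v assume "u \<in> lists A" "v \<in> lists A"
    then show "(\<rho> \<circ> \<sigma>) (u @ v) = (\<rho> \<circ> \<sigma>) u @ (\<rho> \<circ> \<sigma>) v"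
      using \<sigma>.image_append[of u v] \<rho>.image_append[of "\<sigma> u" "\<sigma> v"] \<sigma>B by simp
  next
    fix a assume a: "a \<in> A"
    then have "\<sigma> [a] \<in> lists B" using \<sigma>B by simp
    then have "0 < length (\<rho> (\<sigma> [a]))"
      using \<rho>.length_le[of "\<sigma> [a]"] \<sigma>.length_pos[OF a] by linarith
    then show "(\<rho> \<circ> \<sigma>) [a] \<noteq> []" by simp
  next
    fix c assume "c \<in> C"
    then obtain b where b: "b \<in> B" "c \<in> set (\<rho> [b])"
      using \<rho> unfolding substitution_def by blast
    then obtain a where a: "a \<in> A" "b \<in> set (\<sigma> [a])"
      using \<sigma> unfolding substitution_def by blast
    then show "\<exists>a\<in>A. c \<in> set ((\<rho> \<circ> \<sigma>) [a])"
      using \<rho>.set_image_mono[of b "\<sigma> [a]"] b \<sigma>B[of "[a]"] by auto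
  qed
qed

lemma foldr_comp: "foldr (\<lambda>k f. \<tau> k \<circ> f) ks g = foldr (\<lambda>k f. \<tau> k \<circ> f) ks id \<circ> g"
  by (induction ks) (auto simp: fun_eq_iff)

lemma subst_comp_same [simp]: "subst_comp \<tau> n n = id"
  by (simp add: subst_comp_def)

lemma subst_comp_trans:
  assumes "n \<le> m" "m \<le> k"
  shows "subst_comp \<tau> n m (subst_comp \<tau> m k u) = subst_comp \<tau> n k u"
proof -
  have "[n..<k] = [n..<m] @ [m..<k]" using assms by (metis le_add_diff_inverse upt_add_eq_append)
  then have "subst_comp \<tau> n k = foldr (\<lambda>k f. \<tau> k \<circ> f) [n..<m] (subst_comp \<tau> m k)"
    by (simp add: subst_comp_def)
  also have "\<dots> = subst_comp \<tau> n m \<circ> subst_comp \<tau> m k"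
    unfolding subst_comp_def by (rule foldr_comp)
  finally show ?thesis by simp
qed

lemma subst_comp_Suc: "subst_comp \<tau> m (Suc m) u = \<tau> m u"
  by (simp add: subst_comp_def)

locale primitive_directive_sequence =
  fixes A :: "nat \<Rightarrow> 'a set" and \<tau> :: "nat \<Rightarrow> 'a list \<Rightarrow> 'a list"
  assumes directive: "directive_sequence A \<tau>" and primitive: "primitive A \<tau>"
begin

abbreviation "S \<equiv> subst_comp \<tau>"
abbreviation "X \<equiv> level_subshift A \<tau>"

lemma finite_alphabet [simp]: "finite (A n)"
  and card_alphabet: "2 \<le> card (A n)"
  using directive by (auto simp: directive_sequence_def alphabet_def)

lemma alphabet_nonempty: "A n \<noteq> {}"
  using card_alphabet[of n] by auto

lemma substitution_S: "n \<le> m \<Longrightarrow> substitution (A m) (A n) (S n m)"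
proof (induction m rule: dec_induct)
  case base
  show ?case by (auto simp: substitution_def)
next
  case (step m)
  have "S n (Suc m) = S n m \<circ> \<tau> m"
    using subst_comp_trans[OF step.hyps(1) le_SucI[OF order_refl], of \<tau>] by (auto simp: subst_comp_Suc)
  moreover have "substitution (A (Suc m)) (A m) (\<tau> m)"
    using directive by (simp add: directive_sequence_def)
  ultimately show ?case using substitution_comp[OF _ step.IH] by metis
qed

lemma morphism: "n \<le> m \<Longrightarrow> nonerasing_morphism (A m) (S n m)"
  using substitution_S nonerasing_morphism_of_substitution by blast

lemma S_in_lists: "n \<le> m \<Longrightarrow> u \<in> lists (A m) \<Longrightarrow> S n m u \<in> lists (A n)"
  using substitution_S[of n m] unfolding substitution_def by blast

lemma sublist_S_trans:
  assumes "n \<le> m" "m \<le> k" "u \<in> lists (A k)" "sublist v (S m k u)"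
  shows "sublist (S n m v) (S n k u)"
  using nonerasing_morphism.sublist_image[OF morphism[OF assms(1)] assms(4)] assms
  by (simp add: S_in_lists subst_comp_trans)

definition admissible :: "nat \<Rightarrow> 'a list set" where
  "admissible n = {w. \<exists>m>n. \<exists>a\<in>A m. sublist w (S n m [a])}"

lemma level_subshift_iff: "x \<in> X n \<longleftrightarrow> range x \<subseteq> A n \<and> factors x \<subseteq> admissible n"
  by (auto simp: level_subshift_def admissible_def)

lemma range_level: "x \<in> X n \<Longrightarrow> range x \<subseteq> A n"
  by (simp add: level_subshift_iff)

lemma translate_in_level [simp]: "translate i x \<in> X n \<longleftrightarrow> x \<in> X n"
proof -
  have "range (translate i x) = range x"
  proof (intro equalityI subsetI)
    fix c assume "c \<in> range x"
    then obtain k where "c = translate i x (k - i)" by (auto simp: translate_apply)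
    then show "c \<in> range (translate i x)" by blast
  qed (auto simp: translate_apply)
  then show ?thesis by (simp add: level_subshift_iff)
qed

lemma letter_occurs:
  assumes "n \<le> m" "a \<in> A m"
  obtains c where "c \<in> A n" "sublist [c] (S n m [a])"
proof -
  have "S n m [a] \<noteq> []" using nonerasing_morphism.nonerasing[OF morphism] assms by blast
  then obtain c v where cv: "S n m [a] = c # v" by (cases "S n m [a]") auto
  have "c \<in> A n" using S_in_lists[of n m "[a]"] assms cv by auto
  moreover have "sublist [c] (S n m [a])" by (rule sublist_singleton) (simp add: cv)
  ultimately show ?thesis by (rule that)
qed

text \<open>
  A word that occurs in the image of one letter occurs in the images of all letters of any level so high that the
  images of its letters contain that one letter.
\<close>

lemma admissible_eventually:
  assumes "w \<in> admissible n"
  obtains M where "n < M" "\<And>m b. M \<le> m \<Longrightarrow> b \<in> A m \<Longrightarrow> sublist w (S n m [b])"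
proof -
  from assms obtain k a where k: "n < k" "a \<in> A k" "sublist w (S n k [a])"
    by (auto simp: admissible_def)
  from primitive obtain M where M: "k < M" "\<forall>b\<in>A k. \<forall>a\<in>A M. b \<in> set (S k M [a])"
    unfolding primitive_def by blast
  show ?thesis
  proof (rule that[of M])
    show "n < M" using k M by simp
    fix m b assume m: "M \<le> m" and b: "b \<in> A m"
    then obtain c where c: "c \<in> A M" "sublist [c] (S M m [b])" by (rule letter_occurs)
    have "a \<in> set (S k M [c])" using M(2) k(2) c(1) by blast
    then have "sublist [a] (S k M [c])" by (rule sublist_singleton)
    also have "sublist (S k M [c]) (S k m [b])"
      using M(1) m b c(2) by (intro sublist_S_trans) auto
    finally have "sublist (S n k [a]) (S n m [b])"
      using M(1) m b k(1) by (intro sublist_S_trans) auto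
    with k(3) show "sublist w (S n m [b])" by (rule sublist_order.order_trans)
  qed
qed

text \<open>
  A word over level \<open>M\<close> that contains all letters of its alphabet has at least two of them. The image of
  one of these letters is long already, and the other one adds to it.
\<close>

lemma growing:
  obtains M where "n \<le> M" "\<And>m b. M \<le> m \<Longrightarrow> b \<in> A m \<Longrightarrow> K \<le> length (S n m [b])"
proof (induction K arbitrary: thesis)
  case 0
  then show ?case by auto
next
  case (Suc K)
  obtain M where M: "n \<le> M" "\<And>m b. M \<le> m \<Longrightarrow> b \<in> A m \<Longrightarrow> K \<le> length (S n m [b])"
    using Suc.IH by blast
  from primitive obtain M' where M': "M < M'" "\<forall>b\<in>A M. \<forall>a\<in>A M'. b \<in> set (S M M' [a])"
    unfolding primitive_def by blast
  show ?case
  proof (rule Suc.prems[of M'])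
    show "n \<le> M'" using M M' by simp
    fix m b assume m: "M' \<le> m" and b: "b \<in> A m"
    then obtain c where c: "c \<in> A M'" "sublist [c] (S M' m [b])" by (rule letter_occurs)
    define v where "v = S M m [b]"
    have v: "v \<in> lists (A M)" unfolding v_def using m M' b by (intro S_in_lists) auto
    have "sublist (S M M' [c]) v"
      unfolding v_def using M' m b c by (intro sublist_S_trans) auto
    then have "A M \<subseteq> set v" using M'(2) c(1) set_mono_sublist by blast
    then have "2 \<le> length v"
      using card_alphabet[of M] card_mono[of "set v" "A M"] card_length[of v] by simp
    then obtain e v' where v': "v = e # v'" "v' \<noteq> []" by (cases v) fastforce+
    interpret \<sigma>: nonerasing_morphism "A M" "S n M" using M(1) by (rule morphism)
    have e: "e \<in> A M" "v' \<in> lists (A M)" using v v' by auto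
    have "S n m [b] = S n M v"
      unfolding v_def using M(1) M'(1) m by (simp add: subst_comp_trans)
    then have "length (S n m [b]) = length (S n M [e]) + length (S n M v')"
      using \<sigma>.image_Cons[OF e] v' by simp
    moreover have "0 < length v'" using v'(2) by simp
    moreover have "length v' \<le> length (S n M v')" using e(2) by (rule \<sigma>.length_le)
    ultimately show "Suc K \<le> length (S n m [b])" using M(2)[OF order_refl e(1)] by linarith
  qed
qed

lemma admissible_sublist: "w \<in> admissible n \<Longrightarrow> sublist v w \<Longrightarrow> v \<in> admissible n"
  unfolding admissible_def using sublist_order.order_trans by blast

text \<open>
  Every admissible word occurs in the images of all letters of some high level \<open>M\<close>, and a factor that is
  long with respect to these images contains one of them.
\<close>

lemma level_minimal:
  assumes x: "x \<in> X n" and w: "w \<in> admissible n"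
  shows "w \<in> factors x"
proof -
  obtain M where M: "n < M" "\<And>m b. M \<le> m \<Longrightarrow> b \<in> A m \<Longrightarrow> sublist w (S n m [b])"
    using w by (rule admissible_eventually) blast
  define H where "H = Max ((\<lambda>b. length (S n M [b])) ` A M)"
  have H: "length (S n M [b]) \<le> H" if "b \<in> A M" for b
    unfolding H_def using that by simp
  define f where "f = map x [0..2 * int H]"
  have f: "f \<in> factors x" "2 * H \<le> length f" "f \<noteq> []" by (auto simp: f_def)
  then have "f \<in> admissible n" using x by (auto simp: level_subshift_iff)
  then obtain M' where M': "n < M'" "\<And>m b. M' \<le> m \<Longrightarrow> b \<in> A m \<Longrightarrow> sublist f (S n m [b])"
    by (rule admissible_eventually) blast
  define m where "m = max M M'"
  obtain b where b: "b \<in> A m" using alphabet_nonempty[of m] by blast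
  interpret \<sigma>: nonerasing_morphism "A M" "S n M" using M(1) by (intro morphism) simp
  have "sublist f (S n M (S M m [b]))"
    using M'(2)[of m b] b M(1) by (simp add: m_def subst_comp_trans)
  then obtain c where c: "c \<in> A M" "sublist (S n M [c]) f"
    using \<sigma>.long_sublist_contains_image[of "S M m [b]" f H] S_in_lists[of M m "[b]"] b H f
    by (auto simp: m_def)
  then have "sublist w f" using M(2)[of M c] sublist_order.order_trans by blast
  with f(1) show ?thesis by (rule factors_sublist)
qed

lemma level_closed:
  assumes "\<And>N. \<exists>x\<in>X n. agree_upto N x z"
  shows "z \<in> X n"
proof -
  have "z i \<in> A n" for i
  proof -
    obtain x where x: "x \<in> X n" "agree_upto (nat \<bar>i\<bar>) x z" using assms by blast
    then have "x i = z i" by (simp add: agree_upto_def)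
    then show ?thesis using range_level[OF x(1)] by (metis rangeI subsetD)
  qed
  moreover have "map z [i..j] \<in> admissible n" for i j
  proof -
    obtain x where x: "x \<in> X n" "agree_upto (nat (\<bar>i\<bar> + \<bar>j\<bar>)) x z" using assms by blast
    then have eq: "map z [i..j] = map x [i..j]" by (auto simp: agree_upto_def)
    show ?thesis unfolding eq using x(1) map_upto_in_factors level_subshift_iff by blast
  qed
  ultimately show ?thesis by (auto simp: level_subshift_iff factors_def)
qed

text \<open>Admissible words of growing length, centred at the origin, accumulate at a point of the subshift.\<close>

lemma level_nonempty: "X n \<noteq> {}"
proof -
  have "\<exists>w\<in>admissible n. K \<le> length w" for K
  proof -
    obtain M where "n \<le> M" "\<And>m b. M \<le> m \<Longrightarrow> b \<in> A m \<Longrightarrow> K \<le> length (S n m [b])"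
      by (rule growing) blast
    moreover obtain b where "b \<in> A (Suc M)" using alphabet_nonempty by blast
    ultimately show ?thesis
      by (intro bexI[of _ "S n (Suc M) [b]"]) (auto simp: admissible_def intro!: exI[of _ "Suc M"])
  qed
  then obtain W where W: "\<And>K. W K \<in> admissible n" "\<And>K. K \<le> length (W K)" by metis
  have WA: "set (W K) \<subseteq> A n" for K
  proof -
    obtain m a where "n < m" "a \<in> A m" "sublist (W K) (S n m [a])"
      using W(1)[of K] by (auto simp: admissible_def)
    then show ?thesis
      using S_in_lists[of n m "[a]"] set_mono_sublist by fastforce
  qed
  obtain d where d: "d \<in> A n" using alphabet_nonempty by blast
  \<comment> \<open>\<open>d\<close> only pads the finite words to bi-infinite sequences; it disappears in the limit.\<close>
  define f where "f M i = (if \<bar>i\<bar> \<le> int M then W (2 * M + 1) ! nat (i + int M) else d)" for M i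
  have "f M i \<in> A n" for M i
    using WA[of "2 * M + 1"] W(2)[of "2 * M + 1"] nth_mem[of "nat (i + int M)" "W (2 * M + 1)"] d
    by (auto simp: f_def)
  then obtain z where z: "\<And>N. infinite {M. agree_upto N (f M) z}"
    using cluster_point[of "A n" f] by auto
  have near: "\<exists>M\<ge>N. agree_upto N (f M) z" for N
    using z[of N] unfolding infinite_nat_iff_unbounded_le by blast
  have "z i \<in> A n" for i
    using near[of "nat \<bar>i\<bar>"] \<open>\<And>M i. f M i \<in> A n\<close> by (metis agree_upto_def nat_0_le abs_ge_zero order_refl)
  moreover have "map z [i..j] \<in> admissible n" for i j
  proof -
    define N where "N = nat (\<bar>i\<bar> + \<bar>j\<bar>)"
    from near[of N] obtain M where M: "N \<le> M" "agree_upto N (f M) z" by blast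
    have "map (f M) [- int M..int M] = take (2 * M + 1) (W (2 * M + 1))"
      using W(2)[of "2 * M + 1"] by (intro nth_equalityI) (auto simp: f_def)
    then have adm: "map (f M) [- int M..int M] \<in> admissible n"
      using admissible_sublist[OF W(1)] sublist_take by metis
    have eq: "map z [i..j] = map (f M) [i..j]"
      using M(2) by (auto simp: agree_upto_def N_def)
    have sub: "sublist (map (f M) [i..j]) (map (f M) [- int M..int M])"
    proof (rule sublist_map_upto)
      show "- int M \<le> i" "j \<le> int M" using M(1) by (auto simp: N_def)
    qed
    show ?thesis unfolding eq by (rule admissible_sublist[OF adm sub])
  qed
  ultimately have "z \<in> X n" by (auto simp: level_subshift_iff factors_def)
  then show ?thesis by blast
qed

lemma apply_bi_level:
  assumes y: "y \<in> X n"
  shows "apply_bi (S 0 n) y \<in> X 0"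
proof -
  interpret \<sigma>: nonerasing_morphism "A n" "S 0 n" by (rule morphism) simp
  note yA = range_level[OF y]
  have "w \<in> admissible 0" if w: "w \<in> factors (apply_bi (S 0 n) y)" for w
  proof -
    obtain v where v: "v \<in> factors y" "sublist w (S 0 n v)"
      using \<sigma>.factors_apply_bi[OF yA w] by blast
    then obtain m a where m: "n < m" "a \<in> A m" "sublist v (S n m [a])"
      using y by (auto simp: level_subshift_iff admissible_def)
    have "sublist (S 0 n v) (S 0 m [a])"
      using m by (intro sublist_S_trans[of 0 n m]) auto
    then have "sublist w (S 0 m [a])" using v(2) sublist_order.order_trans by blast
    moreover have "0 < m" using m by simp
    ultimately show ?thesis using m(2) unfolding admissible_def by blast
  qed
  moreover have "set (S 0 n [a]) \<subseteq> A 0" if "a \<in> A n" for a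
    using S_in_lists[of 0 n "[a]"] that by auto
  then have "range (apply_bi (S 0 n) y) \<subseteq> A 0"
    by (rule \<sigma>.range_apply_bi[OF yA])
  ultimately show ?thesis by (auto simp: level_subshift_iff)
qed

end

section \<open>Eigenvalues from letter-coboundaries\<close>

text \<open>Cutting at the visits of \<open>x\<close> to the letter \<open>x p\<close> decomposes the word into return words to this letter.\<close>

lemma letter_coboundary_return:
  assumes c: "letter_coboundary A Y c" and x: "x \<in> Y" "range x \<subseteq> A"
    and "p \<le> q" "x p = x q"
  shows "c (map x [p..q - 1]) = 0"
  using assms(4,5)
proof (induction "nat (q - p)" arbitrary: p rule: less_induct)
  case less
  show ?case
  proof (cases "p = q")
    case True
    then show ?thesis using c by (simp add: letter_coboundary_def)
  next
    case False
    define P where "P d \<longleftrightarrow> 0 < d \<and> x (p + int d) = x p" for d :: nat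
    define r where "r = p + int (LEAST d. P d)"
    have "P (nat (q - p))" using False less.prems by (simp add: P_def)
    then have "P (LEAST d. P d)" "(LEAST d. P d) \<le> nat (q - p)" by (rule LeastI, rule Least_le)
    then have r: "p < r" "r \<le> q" "x r = x p" using False less.prems by (auto simp: P_def r_def)
    have first: "x k \<noteq> x p" if "p < k" "k < r" for k
      using not_less_Least[of "nat (k - p)" P] that by (auto simp: P_def r_def)
    let ?w = "map x [p..r - 1]"
    have w: "?w = x p # map x [p + 1..r - 1]" using r(1) by (simp add: upto_rec1)
    have snoc: "?w @ [x p] = map x [p..r]" using r upto_rec2[of p r] by simp
    have "return_word Y (x p) ?w"
      unfolding return_word_def
    proof (intro conjI)
      show "?w @ [x p] \<in> language Y"
        unfolding snoc language_def using x(1) map_upto_in_factors by blast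
      have "x p \<notin> set (map x [p + 1..r - 1])"
      proof
        assume "x p \<in> set (map x [p + 1..r - 1])"
        then obtain k where "p + 1 \<le> k" "k \<le> r - 1" "x k = x p" by auto
        with first[of k] show False by simp
      qed
      then show "count_list (?w @ [x p]) (x p) = 2" unfolding w by simp
    qed (simp_all add: w suffix_def)
    moreover have "x p \<in> A" using x(2) by auto
    ultimately have "c ?w = 0" using c by (simp add: letter_coboundary_def)
    moreover have "c (map x [r..q - 1]) = 0"
      using less.hyps[of r] less.prems r by simp
    moreover have "map x [p..q - 1] = ?w @ map x [r..q - 1]"
      using r by (intro map_upto_split) auto
    moreover have "map x I \<in> lists A" for I using x(2) by (auto simp: subset_iff)
    ultimately show ?thesis using c by (simp add: letter_coboundary_def)
  qed
qed

context primitive_directive_sequence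
begin

abbreviation tower :: "nat \<Rightarrow> (int \<Rightarrow> 'a) \<Rightarrow> int \<Rightarrow> 'a" where
  "tower n \<equiv> apply_bi (S 0 n)"

text \<open>
  The floors of the tower partition at level \<open>n\<close> are finitely many disjoint compact sets. Hence they have
  positive distance, which means that a window of some fixed size tells in which floor a point lies.
\<close>

lemma recognizability_window:
  assumes rec: "recognizable A \<tau>" and n: "1 \<le> n"
  obtains N where "\<And>y y' k k'. y \<in> X n \<Longrightarrow> y' \<in> X n \<Longrightarrow> k < height \<tau> n [y 0] \<Longrightarrow> k' < height \<tau> n [y' 0] \<Longrightarrow>
      agree_upto N (translate (int k) (tower n y)) (translate (int k') (tower n y')) \<Longrightarrow>
      y 0 = y' 0 \<and> k = k'"
proof (rule ccontr)
  assume "\<not> thesis"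
  then have "\<forall>N. \<exists>y y' k k'. y \<in> X n \<and> y' \<in> X n \<and> k < height \<tau> n [y 0] \<and> k' < height \<tau> n [y' 0] \<and>
      agree_upto N (translate (int k) (tower n y)) (translate (int k') (tower n y')) \<and>
      \<not> (y 0 = y' 0 \<and> k = k')"
    using that by meson
  then obtain y y' k k' where y: "\<And>N. y N \<in> X n" and y': "\<And>N. y' N \<in> X n"
    and k: "\<And>N. k N < height \<tau> n [y N 0]" and k': "\<And>N. k' N < height \<tau> n [y' N 0]"
    and agree: "\<And>N. agree_upto N (translate (int (k N)) (tower n (y N))) (translate (int (k' N)) (tower n (y' N)))"
    and diff: "\<And>N. \<not> (y N 0 = y' N 0 \<and> k N = k' N)"
    by metis
  define H where "H = Max ((\<lambda>a. height \<tau> n [a]) ` A n)"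
  have H: "height \<tau> n [a] \<le> H" if "a \<in> A n" for a
    unfolding H_def using that by simp
  note yA = range_level[OF y] and y'A = range_level[OF y']
  \<comment> \<open>The heights are stored in the letters, so that one cluster point serves both sequences and both heights.\<close>
  define f where "f M i = (y M i, y' M i, k M, k' M)" for M i
  have yin: "y M i \<in> A n" and y'in: "y' M i \<in> A n" for M i
    using yA[of M] y'A[of M] by auto
  have "f M i \<in> A n \<times> A n \<times> {..<H} \<times> {..<H}" for M i
    using yin[of M i] y'in[of M i] k[of M] k'[of M] H[OF yin[of M 0]] H[OF y'in[of M 0]]
    by (simp add: f_def)
  then obtain z where z: "\<And>N. infinite {M. agree_upto N (f M) z}"
    using cluster_point[of "A n \<times> A n \<times> {..<H} \<times> {..<H}" f] by auto
  define u where "u i = fst (z i)" for i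
  define u' where "u' i = fst (snd (z i))" for i
  obtain u0 u0' l l' where z0: "z 0 = (u0, u0', l, l')" by (cases "z 0")
  have near: "\<exists>M\<ge>N. agree_upto N (y M) u \<and> agree_upto N (y' M) u' \<and> k M = l \<and> k' M = l'" for N
  proof -
    have "\<exists>M\<ge>N. agree_upto N (f M) z"
      using z[of N] unfolding infinite_nat_iff_unbounded_le by blast
    then obtain M where M: "M \<ge> N" "agree_upto N (f M) z" by blast
    have "agree_upto N (y M) u" "agree_upto N (y' M) u'"
      unfolding agree_upto_def u_def u'_def
      using M(2) by (metis agree_upto_def f_def fst_conv, metis agree_upto_def f_def fst_conv snd_conv)
    moreover have "f M 0 = z 0" using M(2) by (simp add: agree_upto_def)
    then have "k M = l" "k' M = l'" by (simp_all add: f_def z0)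
    ultimately show ?thesis using M(1) by blast
  qed
  have u: "u \<in> X n" "u' \<in> X n"
    using near y y' by (auto intro!: level_closed) blast+
  from near[of 0] obtain M where M: "y M 0 = u 0" "y' M 0 = u' 0" "k M = l" "k' M = l'"
    by (auto simp: agree_upto_def)
  have "translate (int l) (tower n u) = translate (int l') (tower n u')"
  proof
    fix i
    define N where "N = nat (\<bar>i\<bar> + int l + int l')"
    from near[of N] obtain M where M: "M \<ge> N" "agree_upto N (y M) u" "agree_upto N (y' M) u'" "k M = l" "k' M = l'"
      by blast
    have "tower n u (i + int l) = tower n (y M) (i + int l)"
      using M(2) by (intro apply_bi_local[symmetric]) (auto simp: N_def)
    moreover have "tower n u' (i + int l') = tower n (y' M) (i + int l')"
      using M(3) by (intro apply_bi_local[symmetric]) (auto simp: N_def)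
    moreover have "\<bar>i\<bar> \<le> int M" using M(1) by (simp add: N_def)
    then have "tower n (y M) (i + int l) = tower n (y' M) (i + int l')"
      using agree[of M] M(4,5) by (simp add: agree_upto_def translate_apply)
    ultimately show "translate (int l) (tower n u) i = translate (int l') (tower n u') i"
      unfolding translate_apply by simp
  qed
  moreover have "translate (int l) (tower n u) \<in> (shift ^^ l) ` base A \<tau> n (u 0)"
    using u(1) by (auto simp: base_def funpow_shift_eq_translate)
  moreover have "translate (int l') (tower n u') \<in> (shift ^^ l') ` base A \<tau> n (u' 0)"
    using u(2) by (auto simp: base_def funpow_shift_eq_translate)
  ultimately have meet: "(shift ^^ l) ` base A \<tau> n (u 0) \<inter> (shift ^^ l') ` base A \<tau> n (u' 0) \<noteq> {}"
    by auto
  have in1: "(u 0, l) \<in> (SIGMA a:A n. {..<height \<tau> n [a]})"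
    using k[of M] yin[of M 0] M by auto
  have in2: "(u' 0, l') \<in> (SIGMA a:A n. {..<height \<tau> n [a]})"
    using k'[of M] y'in[of M 0] M by auto
  have "(u 0, l) = (u' 0, l')"
  proof (rule ccontr)
    assume "(u 0, l) \<noteq> (u' 0, l')"
    moreover have "disjoint_family_on (\<lambda>(a, k). (shift ^^ k) ` base A \<tau> n a) (SIGMA a:A n. {..<height \<tau> n [a]})"
      using rec n by (simp add: recognizable_def)
    ultimately have "(\<lambda>(a, k). (shift ^^ k) ` base A \<tau> n a) (u 0, l) \<inter> (\<lambda>(a, k). (shift ^^ k) ` base A \<tau> n a) (u' 0, l') = {}"
      using in1 in2 unfolding disjoint_family_on_def by blast
    with meet show False by simp
  qed
  with diff[of M] M show False by simp
qed

text \<open>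
  Two close visits of \<open>x\<close> to the same place are copied into a point
  \<open>\<tau>\<^sub>0\<^sub>,\<^sub>n(y)\<close>. By recognizability both copies sit at the same height above equal
  letters of \<open>y\<close>. The word of \<open>y\<close> between these letters is a product of return words, so
  that the coboundary vanishes on it, and its height is the time between the two visits.
\<close>

lemma recurrence_of_coboundaries:
  assumes rec: "recognizable A \<tau>"
    and c: "\<And>n. letter_coboundary (A n) (X n) (c n)"
    and lim: "(\<lambda>n. SUP u\<in>language (X n). dist_nearest_int (c n u - \<alpha> * real (height \<tau> n u))) \<longlonglongrightarrow> 0"
    and x: "x \<in> X 0" and "\<epsilon> > 0"
  shows "\<exists>N. \<forall>i j. agree_upto N (translate i x) (translate j x) \<longrightarrow>
           dist_nearest_int (\<alpha> * of_int (i - j)) < \<epsilon>"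
proof -
  from LIMSEQ_D[OF lim \<open>\<epsilon> > 0\<close>] obtain n0 where n0: "\<And>n. n \<ge> n0 \<Longrightarrow>
    (SUP u\<in>language (X n). dist_nearest_int (c n u - \<alpha> * real (height \<tau> n u))) < \<epsilon>"
    by (auto simp: abs_less_iff)
  define n where "n = max 1 n0"
  have n: "1 \<le> n" and sup: "(SUP u\<in>language (X n). dist_nearest_int (c n u - \<alpha> * real (height \<tau> n u))) < \<epsilon>"
    using n0[of n] by (auto simp: n_def)
  have small: "dist_nearest_int (c n u - \<alpha> * real (height \<tau> n u)) < \<epsilon>" if "u \<in> language (X n)" for u
  proof (rule le_less_trans[OF _ sup], rule cSUP_upper[OF that])
    show "bdd_above ((\<lambda>u. dist_nearest_int (c n u - \<alpha> * real (height \<tau> n u))) ` language (X n))"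
      by (rule bdd_aboveI2[where M = "1/2"]) (rule dist_nearest_int_le_half)
  qed
  obtain N where N: "\<And>y y' k k'. y \<in> X n \<Longrightarrow> y' \<in> X n \<Longrightarrow> k < height \<tau> n [y 0] \<Longrightarrow> k' < height \<tau> n [y' 0] \<Longrightarrow>
      agree_upto N (translate (int k) (tower n y)) (translate (int k') (tower n y')) \<Longrightarrow>
      y 0 = y' 0 \<and> k = k'"
    by (rule recognizability_window[OF rec n]) blast
  obtain y where y: "y \<in> X n" using level_nonempty by blast
  interpret \<sigma>: nonerasing_morphism "A n" "S 0 n" by (rule morphism) simp
  note yA = range_level[OF y]
  define z where "z = tower n y"
  have z: "z \<in> X 0" unfolding z_def by (rule apply_bi_level[OF y])
  \<comment> \<open>The copied word covers the windows around both visits, hence its length \<open>d + 1\<close>.\<close>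
  have main: "dist_nearest_int (\<alpha> * of_int (j - i)) < \<epsilon>"
    if ag: "agree_upto N (translate i x) (translate j x)" and "i \<le> j" for i j
  proof -
    define d where "d = j - i + 2 * int N"
    have "map x [i - int N..i - int N + d] \<in> admissible 0"
      using x map_upto_in_factors level_subshift_iff by blast
    with z have "map x [i - int N..i - int N + d] \<in> factors z" by (rule level_minimal)
    then obtain a b where ab: "map x [i - int N..i - int N + d] = map z [a..b]"
      by (auto simp: factors_def)
    have "d \<ge> 0" using \<open>i \<le> j\<close> by (simp add: d_def)
    moreover have "length (map x [i - int N..i - int N + d]) = length (map z [a..b])" using ab by (rule arg_cong)
    ultimately have "b = a + d" by auto
    with ab have copy: "x (i - int N + k) = z (a + k)" if "0 \<le> k" "k \<le> d" for k
      using map_upto_eqD that by blast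
    define i' where "i' = a + int N"
    define j' where "j' = i' + (j - i)"
    have "agree_upto N (translate i' z) (translate j' z)"
      unfolding agree_upto_def translate_apply
    proof (intro allI impI)
      fix k assume k: "\<bar>k\<bar> \<le> int N"
      have "z (k + i') = x (k + i)"
        using copy[of "k + int N"] k \<open>i \<le> j\<close> by (auto simp: i'_def d_def algebra_simps)
      moreover have "z (k + j') = x (k + j)"
        using copy[of "k + int N + (j - i)"] k \<open>i \<le> j\<close> by (auto simp: i'_def j'_def d_def algebra_simps)
      moreover have "x (k + i) = x (k + j)"
        using ag k by (simp add: agree_upto_def translate_apply)
      ultimately show "z (k + i') = z (k + j')" by simp
    qed
    moreover obtain p k where p: "i' = \<sigma>.cut y p + int k" "k < length (S 0 n [y p])"
      using \<sigma>.obtain_cut[OF yA] .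
    moreover obtain q k' where q: "j' = \<sigma>.cut y q + int k'" "k' < length (S 0 n [y q])"
      using \<sigma>.obtain_cut[OF yA] .
    ultimately have "agree_upto N (translate (int k) (tower n (translate p y))) (translate (int k') (tower n (translate q y)))"
      by (simp add: \<sigma>.apply_bi_translate[OF yA] z_def add.commute)
    with N[of "translate p y" "translate q y" k k'] y p(2) q(2) have eq: "y p = y q" "k = k'"
      by (auto simp: height_def translate_apply)
    have time: "\<sigma>.cut y q - \<sigma>.cut y p = j - i" using p(1) q(1) eq(2) by (simp add: j'_def)
    have "p \<le> q"
    proof (rule ccontr)
      assume "\<not> p \<le> q"
      with \<sigma>.cut_diff_ge[OF yA, of q p] time \<open>i \<le> j\<close> show False by simp
    qed
    let ?u = "map y [p..q - 1]"
    have "int (height \<tau> n ?u) = j - i"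
      unfolding height_def using \<sigma>.cut_diff[OF yA \<open>p \<le> q\<close>] time by simp
    then have "real (height \<tau> n ?u) = of_int (j - i)" by (metis of_int_of_nat_eq)
    moreover have "c n ?u = 0" by (rule letter_coboundary_return[OF c y yA \<open>p \<le> q\<close> eq(1)])
    moreover have "?u \<in> language (X n)" using y map_upto_in_factors unfolding language_def by blast
    ultimately show ?thesis using small[of ?u] by (metis diff_0 dist_nearest_int_minus)
  qed
  show ?thesis
  proof (intro exI[of _ N] allI impI)
    fix i j assume ag: "agree_upto N (translate i x) (translate j x)"
    show "dist_nearest_int (\<alpha> * of_int (i - j)) < \<epsilon>"
    proof (cases "i \<le> j")
      case True
      with main[OF ag] show ?thesis
        using dist_nearest_int_minus[of "\<alpha> * of_int (j - i)"] by (simp add: algebra_simps)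
    next
      case False
      then show ?thesis using main[OF agree_upto_sym[OF ag]] by simp
    qed
  qed
qed

lemma eigenvalue_of_coboundaries:
  assumes closed: "closedin (full_shift (A 0)) (X 0)" and rec: "recognizable A \<tau>"
    and c: "\<And>n. letter_coboundary (A n) (X n) (c n)"
    and lim: "(\<lambda>n. SUP u\<in>language (X n). dist_nearest_int (c n u - \<alpha> * real (height \<tau> n u))) \<longlonglongrightarrow> 0"
  shows "eigenvalue (A 0) (X 0) \<alpha>"
proof -
  obtain x where x: "x \<in> X 0" using level_nonempty by blast
  have dense: "\<exists>i. agree_upto N (translate i x) y" if y: "y \<in> X 0" for y N
  proof -
    have "map y [- int N..- int N + 2 * int N] \<in> admissible 0"
      using y map_upto_in_factors level_subshift_iff by blast
    with x have "map y [- int N..- int N + 2 * int N] \<in> factors x" by (rule level_minimal)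
    then obtain a b where ab: "map y [- int N..- int N + 2 * int N] = map x [a..b]"
      by (auto simp: factors_def)
    have "length (map y [- int N..- int N + 2 * int N]) = length (map x [a..b])" using ab by (rule arg_cong)
    then have "b = a + 2 * int N" by auto
    with ab have copy: "y (- int N + k) = x (a + k)" if "0 \<le> k" "k \<le> 2 * int N" for k
      using map_upto_eqD that by blast
    have "agree_upto N (translate (a + int N) x) y"
      unfolding agree_upto_def translate_apply
    proof (intro allI impI)
      fix k assume "\<bar>k\<bar> \<le> int N"
      then show "x (k + (a + int N)) = y k" using copy[of "k + int N"] by (auto simp: algebra_simps)
    qed
    then show ?thesis by blast
  qed
  obtain G where "\<And>y. y \<in> X 0 \<Longrightarrow> shift y \<in> X 0 \<Longrightarrow> G (shift y) - G y - \<alpha> \<in> \<int>" "uniform_mod_1 (X 0) G"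
    using lift_of_recurrence[OF dense recurrence_of_coboundaries[OF rec c lim x]] by blast
  then show ?thesis
    by (intro eigenvalue_of_lift[OF closed]) (simp_all add: shift_eq_translate)
qed

end

section \<open>Letter-coboundaries from eigenvalues\<close>

context primitive_directive_sequence
begin

lemma language_pairE:
  assumes "[a, b] \<in> language (X n)"
  obtains z where "z \<in> X n" "z (- 1) = a" "z 0 = b"
proof -
  from assms obtain x where x: "x \<in> X n" and fac: "[a, b] \<in> factors x"
    unfolding language_def by blast
  from fac obtain i j where "[a, b] = map x [i..j]"
    unfolding factors_def mem_Collect_eq by (elim exE conjE)
  then have eq: "map x [i..j] = [a, b]" by simp
  then have "length (map x [i..j]) = length [a, b]" by (rule arg_cong)
  then have "j = i + 1" by auto
  with eq have ab: "x i = a" "x (i + 1) = b" by (simp_all add: upto_rec1)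
  show ?thesis
    by (rule that[of "translate (i + 1) x"]) (use x ab in \<open>simp_all add: translate_apply add.commute\<close>)
qed

lemma tower_right:
  assumes "y \<in> X n" "k < height \<tau> n [y 0]"
  shows "tower n y (int k) = S 0 n [y 0] ! k"
proof -
  interpret \<sigma>: nonerasing_morphism "A n" "S 0 n" by (rule morphism) simp
  show ?thesis
    using \<sigma>.apply_bi_cut[OF range_level[OF assms(1)], of k 0] assms
    by (simp add: height_def \<sigma>.cut_0[OF range_level[OF assms(1)]])
qed

lemma tower_left:
  assumes "y \<in> X n" "k < height \<tau> n [y (- 1)]"
  shows "tower n y (int k - int (height \<tau> n [y (- 1)])) = S 0 n [y (- 1)] ! k"
proof -
  interpret \<sigma>: nonerasing_morphism "A n" "S 0 n" by (rule morphism) simp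
  have "\<sigma>.cut y (- 1) = - int (height \<tau> n [y (- 1)])"
    using \<sigma>.cut_Suc[OF range_level[OF assms(1)], of "- 1"]
    by (simp add: height_def \<sigma>.cut_0[OF range_level[OF assms(1)]])
  then show ?thesis
    using \<sigma>.apply_bi_cut[OF range_level[OF assms(1)], of k "- 1"] assms
    by (simp add: height_def algebra_simps)
qed

text \<open>
  The coboundaries are going to be differences of a potential on letters. Such a difference comes from a function of
  the single letter \<open>a\<close> only if \<open>a\<close> determines the potential of the letter after it. This
  forces the potential to be constant on the classes that are generated by pairs of letters with a common predecessor.
\<close>

definition siblings :: "nat \<Rightarrow> ('a \<times> 'a) set" where
  "siblings n = {(b, b'). \<exists>a\<in>A n. [a, b] \<in> language (X n) \<and> [a, b'] \<in> language (X n)}"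

definition sibling_class :: "nat \<Rightarrow> 'a \<Rightarrow> 'a set" where
  "sibling_class n b = (siblings n)\<^sup>* `` {b}"

lemma language_letters: "u \<in> language (X n) \<Longrightarrow> set u \<subseteq> A n"
  unfolding language_def using set_factors range_level by fastforce

lemma siblings_subset: "siblings n \<subseteq> A n \<times> A n"
  using language_letters unfolding siblings_def by fastforce

lemma sibling_class_eq:
  assumes "(b, b') \<in> siblings n"
  shows "sibling_class n b = sibling_class n b'"
proof -
  have "(b', b) \<in> siblings n" using assms by (auto simp: siblings_def)
  with assms show ?thesis
    unfolding sibling_class_def by (auto intro: converse_rtrancl_into_rtrancl)
qed

context
  fixes G :: "(int \<Rightarrow> 'a) \<Rightarrow> real" and \<alpha> :: real
  assumes equivariant: "\<And>x. x \<in> X 0 \<Longrightarrow> G (shift x) - G x - \<alpha> \<in> \<int>"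
    and uniform: "uniform_mod_1 (X 0) G"
begin

lemma lift_translate:
  assumes x: "x \<in> X 0"
  shows "G (translate i x) - G x - \<alpha> * of_int i \<in> \<int>"
proof (induction i rule: int_induct[where k = 0])
  case base
  show ?case by simp
next
  case (step1 i)
  have "G (translate (i + 1) x) - G (translate i x) - \<alpha> \<in> \<int>"
    using equivariant[of "translate i x"] x by (simp add: shift_eq_translate add.commute)
  from Ints_add[OF this step1.IH] show ?case by (simp add: algebra_simps)
next
  case (step2 i)
  have "G (translate i x) - G (translate (i - 1) x) - \<alpha> \<in> \<int>"
    using equivariant[of "translate (i - 1) x"] x by (simp add: shift_eq_translate)
  from Ints_diff[OF step2.IH this] show ?case by (simp add: algebra_simps)
qed

text \<open>
  It does not matter where the long interval lies on which two points agree: translating both points changes the two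
  values of the lift by the same amount.
\<close>

lemma lift_close:
  assumes "\<epsilon> > 0"
  obtains K where "\<And>x y i. x \<in> X 0 \<Longrightarrow> y \<in> X 0 \<Longrightarrow> (\<And>k. k < K \<Longrightarrow> x (i + int k) = y (i + int k)) \<Longrightarrow>
    dist_nearest_int (G x - G y) < \<epsilon>"
proof -
  from uniform assms obtain N where N: "\<And>x y. x \<in> X 0 \<Longrightarrow> y \<in> X 0 \<Longrightarrow> agree_upto N x y \<Longrightarrow>
      dist_nearest_int (G x - G y) < \<epsilon>"
    unfolding uniform_mod_1_def by blast
  show ?thesis
    \<comment> \<open>An interval of this length is a window of radius \<open>N\<close> around its midpoint, which is moved to the origin.\<close>
  proof (rule that[of "2 * N + 1"])
    fix x y i assume x: "x \<in> X 0" and y: "y \<in> X 0"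
      and eq: "\<And>k. k < 2 * N + 1 \<Longrightarrow> x (i + int k) = y (i + int k)"
    define j where "j = i + int N"
    have "agree_upto N (translate j x) (translate j y)"
      unfolding agree_upto_def translate_apply
    proof (intro allI impI)
      fix k assume "\<bar>k\<bar> \<le> int N"
      then have k: "0 \<le> k + int N" "nat (k + int N) < 2 * N + 1" by linarith+
      from eq[OF k(2)] k(1) show "x (k + j) = y (k + j)" by (simp add: j_def ac_simps)
    qed
    then have "dist_nearest_int (G (translate j x) - G (translate j y)) < \<epsilon>"
      using N x y by simp
    moreover have "(G (translate j x) - G (translate j y)) - (G x - G y) \<in> \<int>"
      using Ints_diff[OF lift_translate[OF x, of j] lift_translate[OF y, of j]] by (simp add: algebra_simps)
    ultimately show "dist_nearest_int (G x - G y) < \<epsilon>"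
      using dist_nearest_int_cong by fastforce
  qed
qed

definition class_oscillation_le :: "nat \<Rightarrow> real \<Rightarrow> bool" where
  "class_oscillation_le n \<delta> \<longleftrightarrow>
    (\<forall>y\<in>X n. \<forall>y'\<in>X n. (y 0, y' 0) \<in> (siblings n)\<^sup>* \<longrightarrow>
       dist_nearest_int (G (tower n y) - G (tower n y')) \<le> \<delta>)"

text \<open>
  In a decisive sequence the images of two siblings begin with the same letter of the preceding level. So do, then,
  the images of all letters of a class, and the points above them share the long image of this letter.
\<close>

lemma class_oscillation_decisive:
  assumes dec: "decisive A \<tau>" and "\<epsilon> > 0"
  shows "\<exists>n0. \<forall>n\<ge>n0. class_oscillation_le n \<epsilon>"
proof -
  obtain K where K: "\<And>x y i. x \<in> X 0 \<Longrightarrow> y \<in> X 0 \<Longrightarrow> (\<And>k. k < K \<Longrightarrow> x (i + int k) = y (i + int k)) \<Longrightarrow>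
    dist_nearest_int (G x - G y) < \<epsilon>"
    by (rule lift_close[OF \<open>\<epsilon> > 0\<close>]) blast
  obtain M where M: "\<And>m b. M \<le> m \<Longrightarrow> b \<in> A m \<Longrightarrow> K \<le> length (S 0 m [b])"
    by (rule growing[of 0 K]) blast
  have "class_oscillation_le (Suc m) \<epsilon>" if m: "M \<le> m" for m
    unfolding class_oscillation_le_def
  proof (intro ballI impI)
    fix y y' assume y: "y \<in> X (Suc m)" "y' \<in> X (Suc m)" and rel: "(y 0, y' 0) \<in> (siblings (Suc m))\<^sup>*"
    from dec obtain r where r: "\<And>a b. a \<in> A (Suc m) \<Longrightarrow> b \<in> A (Suc m) \<Longrightarrow>
        [a, b] \<in> language (X (Suc m)) \<Longrightarrow> prefix [r a] (\<tau> m [b])"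
      unfolding decisive_def by metis
    have step: "hd (\<tau> m [b]) = hd (\<tau> m [b'])" if "(b, b') \<in> siblings (Suc m)" for b b'
    proof -
      from that obtain a where a: "a \<in> A (Suc m)" "[a, b] \<in> language (X (Suc m))" "[a, b'] \<in> language (X (Suc m))"
        by (auto simp: siblings_def)
      then have "prefix [r a] (\<tau> m [b])" "prefix [r a] (\<tau> m [b'])"
        using r[of a] siblings_subset that by blast+
      then show ?thesis by (auto simp: prefix_def)
    qed
    have "hd (\<tau> m [b]) = hd (\<tau> m [b'])" if "(b, b') \<in> (siblings (Suc m))\<^sup>*" for b b'
      using that by (induction rule: rtrancl_induct) (auto dest: step)
    with rel have hd: "hd (\<tau> m [y 0]) = hd (\<tau> m [y' 0])" by blast
    define h where "h = hd (\<tau> m [y 0])"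
    have begins: "z 0 \<in> A (Suc m) \<and> prefix (S 0 m [h]) (S 0 (Suc m) [z 0]) \<and> h \<in> A m"
      if z_level: "z \<in> X (Suc m)" and z_hd: "hd (\<tau> m [z 0]) = h" for z
    proof -
      interpret \<sigma>: nonerasing_morphism "A m" "S 0 m" by (rule morphism) simp
      interpret \<tau>: nonerasing_morphism "A (Suc m)" "S m (Suc m)" by (rule morphism) simp
      have z: "z 0 \<in> A (Suc m)" using range_level[OF z_level] by auto
      have "\<tau> m [z 0] \<noteq> []" using \<tau>.nonerasing[OF z] by (simp add: subst_comp_Suc)
      then obtain v where v: "\<tau> m [z 0] = h # v" using z_hd by (cases "\<tau> m [z 0]") auto
      moreover have "\<tau> m [z 0] \<in> lists (A m)"
        using S_in_lists[of m "Suc m" "[z 0]"] z by (simp add: subst_comp_Suc)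
      ultimately have h: "h \<in> A m" "v \<in> lists (A m)" by auto
      have "S 0 (Suc m) [z 0] = S 0 m (\<tau> m [z 0])"
        using subst_comp_trans[of 0 m "Suc m" \<tau> "[z 0]"] by (simp add: subst_comp_Suc)
      also have "\<dots> = S 0 m [h] @ S 0 m v" unfolding v by (rule \<sigma>.image_Cons[OF h])
      finally show ?thesis using z h by simp
    qed
    have image_of_h: "tower (Suc m) z (0 + int k) = S 0 m [h] ! k"
      if z_level: "z \<in> X (Suc m)" and z_hd: "hd (\<tau> m [z 0]) = h" and k: "k < K" for z k
    proof -
      from begins[OF z_level z_hd] obtain s where s: "S 0 (Suc m) [z 0] = S 0 m [h] @ s" and h: "h \<in> A m"
        by (auto simp: prefix_def)
      then have "k < length (S 0 m [h])" using M[OF m h] k by simp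
      then show ?thesis
        using tower_right[OF z_level, of k] s by (simp add: height_def nth_append)
    qed
    have "dist_nearest_int (G (tower (Suc m) y) - G (tower (Suc m) y')) < \<epsilon>"
    proof (rule K)
      show "tower (Suc m) y \<in> X 0" "tower (Suc m) y' \<in> X 0" using y by (simp_all add: apply_bi_level)
      show "tower (Suc m) y (0 + int k) = tower (Suc m) y' (0 + int k)" if "k < K" for k
        using image_of_h[OF y(1) _ that] image_of_h[OF y(2) _ that] hd by (simp add: h_def)
    qed
    then show "dist_nearest_int (G (tower (Suc m) y) - G (tower (Suc m) y')) \<le> \<epsilon>" by simp
  qed
  then have "\<forall>n\<ge>Suc M. class_oscillation_le n \<epsilon>" by (metis Suc_le_D Suc_le_mono)
  then show ?thesis ..
qed

text \<open>
  Points above the same letter \<open>b\<close> share the image of \<open>b\<close> to the right of the origin, and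
  suitable points above two siblings share the image of the common predecessor to the left of it. A chain of
  \<open>k\<close> steps between siblings therefore costs \<open>2 k + 1\<close> comparisons, and over boundedly many
  letters chains can be taken boundedly long.
\<close>

lemma class_oscillation_bounded:
  assumes bdd: "bdd_above (range (\<lambda>n. card (A n)))" and "\<epsilon> > 0"
  shows "\<exists>n0. \<forall>n\<ge>n0. class_oscillation_le n \<epsilon>"
proof -
  from bdd obtain B where B: "\<And>n. card (A n) \<le> B" by (auto simp: bdd_above_def)
  \<comment> \<open>There are at most \<open>B * B\<close> pairs of siblings, and a shortest chain uses no pair twice.\<close>
  define \<delta> where "\<delta> = \<epsilon> / real (2 * (B * B) + 1)"
  have "\<delta> > 0" unfolding \<delta>_def by (rule divide_pos_pos[OF \<open>\<epsilon> > 0\<close>]) linarith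
  obtain K where K: "\<And>x y i. x \<in> X 0 \<Longrightarrow> y \<in> X 0 \<Longrightarrow> (\<And>k. k < K \<Longrightarrow> x (i + int k) = y (i + int k)) \<Longrightarrow>
    dist_nearest_int (G x - G y) < \<delta>"
    by (rule lift_close[OF \<open>\<delta> > 0\<close>]) blast
  obtain M where M: "\<And>m b. M \<le> m \<Longrightarrow> b \<in> A m \<Longrightarrow> K \<le> length (S 0 m [b])"
    by (rule growing[of 0 K]) blast
  have "class_oscillation_le n \<epsilon>" if n: "M \<le> n" for n
  proof -
    have letter: "y i \<in> A n" if "y \<in> X n" for y i using range_level[OF that] by auto
    have right: "dist_nearest_int (G (tower n y) - G (tower n y')) \<le> \<delta>"
      if y: "y \<in> X n" "y' \<in> X n" "y 0 = y' 0" for y y'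
    proof -
      have "tower n y (0 + int k) = tower n y' (0 + int k)" if "k < K" for k
        using tower_right[OF y(1), of k] tower_right[OF y(2), of k] y(3) that M[OF n letter[OF y(1)], of 0]
        by (simp add: height_def)
      then show ?thesis
        using K[of "tower n y" "tower n y'" 0] y apply_bi_level by fastforce
    qed
    have left: "dist_nearest_int (G (tower n y) - G (tower n y')) \<le> \<delta>"
      if y: "y \<in> X n" "y' \<in> X n" "y (- 1) = y' (- 1)" for y y'
    proof -
      let ?h = "int (height \<tau> n [y (- 1)])"
      have "tower n y (- ?h + int k) = tower n y' (- ?h + int k)" if "k < K" for k
        using tower_left[OF y(1), of k] tower_left[OF y(2), of k] y(3) that M[OF n letter[OF y(1)], of "- 1"]
        by (simp add: height_def)
      then show ?thesis
        using K[of "tower n y" "tower n y'" "- ?h"] y apply_bi_level by fastforce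
    qed
    have chain: "dist_nearest_int (G (tower n y) - G (tower n y')) \<le> real (2 * k + 1) * \<delta>"
      if "y \<in> X n" "y' \<in> X n" "(y 0, y' 0) \<in> siblings n ^^ k" for k y y'
      using that
    proof (induction k arbitrary: y')
      case 0
      then show ?case using right[of y y'] by simp
    next
      case (Suc k)
      then obtain b where b: "(y 0, b) \<in> siblings n ^^ k" "(b, y' 0) \<in> siblings n" by auto
      then obtain a where a: "[a, b] \<in> language (X n)" "[a, y' 0] \<in> language (X n)"
        by (auto simp: siblings_def)
      obtain z where z: "z \<in> X n" "z (- 1) = a" "z 0 = b" using a(1) by (rule language_pairE)
      obtain z' where z': "z' \<in> X n" "z' (- 1) = a" "z' 0 = y' 0" using a(2) by (rule language_pairE)
      let ?D = "\<lambda>u v. dist_nearest_int (G (tower n u) - G (tower n v))"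
      have "?D y z \<le> real (2 * k + 1) * \<delta>" using Suc.IH[of z] Suc.prems(1) z b(1) by simp
      moreover have "?D z z' \<le> \<delta>" using left[of z z'] z z' by simp
      moreover have "?D z' y' \<le> \<delta>" using right[of z' y'] z' Suc.prems(2) by simp
      moreover have "?D y y' \<le> ?D y z + ?D z y'" "?D z y' \<le> ?D z z' + ?D z' y'"
        by (rule dist_nearest_int_triangle)+
      ultimately have "?D y y' \<le> real (2 * k + 1) * \<delta> + 2 * \<delta>" by linarith
      then show ?case by (simp add: algebra_simps)
    qed
    show ?thesis
      unfolding class_oscillation_le_def
    proof (intro ballI impI)
      fix y y' assume y: "y \<in> X n" "y' \<in> X n" and rel: "(y 0, y' 0) \<in> (siblings n)\<^sup>*"
      have fin: "finite (siblings n)" by (rule finite_subset[OF siblings_subset]) simp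
      have "card (siblings n) \<le> card (A n \<times> A n)" by (rule card_mono[OF _ siblings_subset]) simp
      also have "\<dots> \<le> B * B" using B[of n] by (simp add: card_cartesian_product mult_le_mono)
      finally have card: "card (siblings n) \<le> B * B" .
      from rel obtain k where k: "k \<le> card (siblings n)" "(y 0, y' 0) \<in> siblings n ^^ k"
        using rtrancl_finite_eq_relpow[OF fin] by auto
      have "dist_nearest_int (G (tower n y) - G (tower n y')) \<le> real (2 * k + 1) * \<delta>"
        by (rule chain[OF y k(2)])
      also have "\<dots> \<le> real (2 * (B * B) + 1) * \<delta>"
        using k(1) card \<open>\<delta> > 0\<close> by (intro mult_right_mono) (auto simp del: of_nat_mult simp flip: of_nat_mult)
      also have "\<dots> = \<epsilon>"
        unfolding \<delta>_def times_divide_eq_right by (rule nonzero_mult_div_cancel_left) linarith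
      finally show "dist_nearest_int (G (tower n y) - G (tower n y')) \<le> \<epsilon>" .
    qed
  qed
  then show ?thesis by blast
qed

text \<open>
  The point at which the lift is evaluated is chosen for a whole class, which makes the potential exactly constant on
  classes. For \<open>b\<close> alone it is a correct choice only up to the oscillation of the lift over the class.
\<close>

definition potential :: "nat \<Rightarrow> 'a \<Rightarrow> real" where
  "potential n b = G (tower n (SOME y. y \<in> X n \<and> y 0 \<in> sibling_class n b))"

definition successor :: "nat \<Rightarrow> 'a \<Rightarrow> 'a" where
  "successor n a = (SOME b. [a, b] \<in> language (X n))"

definition potential_difference :: "nat \<Rightarrow> 'a list \<Rightarrow> real" where
  "potential_difference n u = (\<Sum>a\<leftarrow>u. potential n (successor n a) - potential n a)"

lemma potential_successor:
  assumes "[a, b] \<in> language (X n)"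
  shows "potential n (successor n a) = potential n b"
proof -
  have "[a, successor n a] \<in> language (X n)"
    unfolding successor_def using assms by (rule someI)
  moreover have "a \<in> A n" using language_letters[OF assms] by simp
  ultimately have "(successor n a, b) \<in> siblings n" using assms by (auto simp: siblings_def)
  then show ?thesis by (simp add: potential_def sibling_class_eq)
qed

lemma potential_difference_telescopes:
  assumes y: "y \<in> X n" and "p \<le> q"
  shows "potential_difference n (map y [p..q - 1]) = potential n (y q) - potential n (y p)"
  using assms(2)
proof (induction q rule: int_ge_induct)
  case base
  show ?case by (simp add: potential_difference_def)
next
  case (step q)
  have "map y [q..q + 1] = [y q, y (q + 1)]" by (simp add: upto_rec1)
  then have "[y q, y (q + 1)] \<in> language (X n)"
    using y map_upto_in_factors[of y q "q + 1"] unfolding language_def by auto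
  then have "potential n (successor n (y q)) = potential n (y (q + 1))" by (rule potential_successor)
  moreover have "map y [p..q] = map y [p..q - 1] @ [y q]" using step.hyps by (simp add: upto_rec2)
  ultimately show ?case using step.IH by (simp add: potential_difference_def)
qed

lemma letter_coboundary_potential_difference:
  "letter_coboundary (A n) (X n) (potential_difference n)"
  unfolding letter_coboundary_def
proof (intro conjI ballI allI impI)
  show "potential_difference n [] = 0" by (simp add: potential_difference_def)
  show "potential_difference n (u @ v) = potential_difference n u + potential_difference n v" for u v
    by (simp add: potential_difference_def)
next
  fix a w assume "return_word (X n) a w"
  then have w: "w @ [a] \<in> language (X n)" "count_list (w @ [a]) a = 2" "prefix [a] (w @ [a])"
    by (auto simp: return_word_def)
  then obtain y i j where y: "y \<in> X n" and eq: "w @ [a] = map y [i..j]"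
    unfolding language_def factors_def by blast
  then have ij: "i \<le> j" by (cases "i \<le> j") auto
  then have "map y [i..j] = map y [i..j - 1] @ [y j]" by (simp add: upto_rec2)
  with eq have last: "w = map y [i..j - 1]" "y j = a" by auto
  have "map y [i..j] = y i # map y [i + 1..j]" using ij by (simp add: upto_rec1)
  then have "y i = a" using w(3) eq by simp
  then show "potential_difference n w = 0"
    using potential_difference_telescopes[OF y ij] last by simp
qed

lemma potential_close:
  assumes "class_oscillation_le n \<delta>" and y: "y \<in> X n"
  shows "dist_nearest_int (potential n (y 0) - G (tower n y)) \<le> \<delta>"
proof -
  let ?z = "SOME z. z \<in> X n \<and> z 0 \<in> sibling_class n (y 0)"
  have "y \<in> X n \<and> y 0 \<in> sibling_class n (y 0)" using y by (simp add: sibling_class_def)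
  then have "?z \<in> X n \<and> ?z 0 \<in> sibling_class n (y 0)"
    by (rule someI[where P = "\<lambda>z. z \<in> X n \<and> z 0 \<in> sibling_class n (y 0)"])
  then have "dist_nearest_int (G (tower n y) - G (tower n ?z)) \<le> \<delta>"
    using assms by (auto simp: class_oscillation_le_def sibling_class_def)
  then show ?thesis unfolding potential_def by (subst dist_nearest_int_commute)
qed

text \<open>
  Along a word the lift changes by \<open>\<alpha>\<close> times the height of the word, modulo 1, and the potential
  follows the lift up to an error \<open>\<delta>\<close> at each of the two ends.
\<close>

lemma potential_difference_close:
  assumes osc: "class_oscillation_le n \<delta>" and u: "u \<in> language (X n)"
  shows "dist_nearest_int (potential_difference n u - \<alpha> * real (height \<tau> n u)) \<le> 2 * \<delta>"
proof -
  from u obtain y i j where y: "y \<in> X n" and "u = map y [i..j]"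
    unfolding language_def factors_def by blast
  \<comment> \<open>The maximum matters for the empty word only, where \<open>j\<close> may be arbitrarily far below \<open>i\<close>.\<close>
  define q where "q = max i (j + 1)"
  have q: "i \<le> q" and u: "u = map y [i..q - 1]"
    using \<open>u = map y [i..j]\<close> by (auto simp: q_def max_def)
  interpret \<sigma>: nonerasing_morphism "A n" "S 0 n" by (rule morphism) simp
  note yA = range_level[OF y]
  define x where "x = tower n y"
  have x: "x \<in> X 0" unfolding x_def by (rule apply_bi_level[OF y])
  define h where "h = \<sigma>.cut y q - \<sigma>.cut y i"
  have "int (height \<tau> n u) = h"
    unfolding h_def height_def u by (rule \<sigma>.cut_diff[OF yA q, symmetric])
  then have h: "real (height \<tau> n u) = of_int h" by (metis of_int_of_nat_eq)
  define s where "s = G (translate (\<sigma>.cut y i) x)"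
  define t where "t = G (translate (\<sigma>.cut y q) x)"
  have "t - s - \<alpha> * of_int h \<in> \<int>"
    using lift_translate[of "translate (\<sigma>.cut y i) x" h] x by (simp add: s_def t_def h_def)
  moreover have "dist_nearest_int (potential n (y i) - s) \<le> \<delta>"
    using potential_close[OF osc, of "translate i y"] y
    by (simp add: s_def x_def \<sigma>.apply_bi_translate[OF yA] translate_apply[of i y 0])
  moreover have "dist_nearest_int (potential n (y q) - t) \<le> \<delta>"
    using potential_close[OF osc, of "translate q y"] y
    by (simp add: t_def x_def \<sigma>.apply_bi_translate[OF yA] translate_apply[of q y 0])
  moreover have "dist_nearest_int ((potential n (y q) - t) - (potential n (y i) - s)) \<le>
      dist_nearest_int (potential n (y q) - t) + dist_nearest_int (potential n (y i) - s)"
    using dist_nearest_int_triangle[of "potential n (y q) - t" "potential n (y i) - s" 0]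
      dist_nearest_int_commute[of 0 "potential n (y i) - s"] by simp
  moreover have "dist_nearest_int (potential_difference n u - \<alpha> * real (height \<tau> n u)) =
      dist_nearest_int ((potential n (y q) - t) - (potential n (y i) - s))"
    using \<open>t - s - \<alpha> * of_int h \<in> \<int>\<close>
    by (intro dist_nearest_int_cong) (simp add: h potential_difference_telescopes[OF y q, folded u] algebra_simps)
  ultimately show ?thesis by linarith
qed

lemma coboundaries_of_lift:
  assumes "decisive A \<tau> \<or> bdd_above (range (\<lambda>n. card (A n)))"
  shows "\<exists>c. (\<forall>n. letter_coboundary (A n) (X n) (c n)) \<and>
    (\<lambda>n. SUP u\<in>language (X n). dist_nearest_int (c n u - \<alpha> * real (height \<tau> n u))) \<longlonglongrightarrow> 0"
proof (intro exI[of _ potential_difference] conjI allI letter_coboundary_potential_difference LIMSEQ_I)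
  fix \<epsilon> :: real assume "\<epsilon> > 0"
  then have "\<epsilon> / 3 > 0" by simp
  from assms have "\<exists>n0. \<forall>n\<ge>n0. class_oscillation_le n (\<epsilon> / 3)"
    by (elim disjE class_oscillation_decisive[OF _ \<open>\<epsilon> / 3 > 0\<close>] class_oscillation_bounded[OF _ \<open>\<epsilon> / 3 > 0\<close>])
  then obtain n0 where n0: "\<And>n. n \<ge> n0 \<Longrightarrow> class_oscillation_le n (\<epsilon> / 3)" by blast
  have "norm ((SUP u\<in>language (X n). dist_nearest_int (potential_difference n u - \<alpha> * real (height \<tau> n u))) - 0) < \<epsilon>"
    if "n \<ge> n0" for n
  proof -
    let ?d = "\<lambda>u. dist_nearest_int (potential_difference n u - \<alpha> * real (height \<tau> n u))"
    obtain y where y: "y \<in> X n" using level_nonempty by blast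
    have mem: "map y [1..0] \<in> language (X n)" using y map_upto_in_factors unfolding language_def by blast
    have le: "?d u \<le> 2 * (\<epsilon> / 3)" if "u \<in> language (X n)" for u
      using potential_difference_close[OF n0[OF \<open>n \<ge> n0\<close>] that] .
    have "(SUP u\<in>language (X n). ?d u) \<le> 2 * (\<epsilon> / 3)"
      using mem le by (intro cSUP_least) auto
    moreover have "0 \<le> (SUP u\<in>language (X n). ?d u)"
    proof (rule cSUP_upper2[OF _ mem])
      show "bdd_above (?d ` language (X n))" using le by (rule bdd_aboveI2)
    qed simp
    ultimately show ?thesis using \<open>\<epsilon> > 0\<close> by simp
  qed
  then show "\<exists>n0. \<forall>n\<ge>n0. norm ((SUP u\<in>language (X n).
      dist_nearest_int (potential_difference n u - \<alpha> * real (height \<tau> n u))) - 0) < \<epsilon>" by blast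
qed

end

end

theorem theorem5p1:
  fixes A :: "nat \<Rightarrow> 'a set"
    and \<tau> :: "nat \<Rightarrow> 'a list \<Rightarrow> 'a list"
    and X :: "(int \<Rightarrow> 'a) set"
    and \<alpha> :: real
  assumes "directive_sequence A \<tau>"
    and "subshift (A 0) X"
    and "generates A \<tau> X"
    and "primitive A \<tau>"
    and "recognizable A \<tau>"
    and "decisive A \<tau> \<or> bdd_above (range (\<lambda>n. card (A n)))"
  shows "eigenvalue (A 0) X \<alpha> \<longleftrightarrow>
    (\<exists>c :: nat \<Rightarrow> 'a list \<Rightarrow> real.
       (\<forall>n. letter_coboundary (A n) (level_subshift A \<tau> n) (c n)) \<and>
       (\<lambda>n. SUP u\<in>language (level_subshift A \<tau> n).
              dist_nearest_int (c n u - \<alpha> * real (height \<tau> n u))) \<longlonglongrightarrow> 0)"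
proof -
  interpret primitive_directive_sequence A \<tau>
    using assms(1,4) by unfold_locales
  have X: "X = level_subshift A \<tau> 0" using assms(3) by (simp add: generates_def)
  have closed: "closedin (full_shift (A 0)) (level_subshift A \<tau> 0)"
    using assms(2) by (simp add: subshift_def X)
  show ?thesis
  proof
    assume "eigenvalue (A 0) X \<alpha>"
    then obtain G where "\<And>x. x \<in> level_subshift A \<tau> 0 \<Longrightarrow> G (shift x) - G x - \<alpha> \<in> \<int>"
      "uniform_mod_1 (level_subshift A \<tau> 0) G"
      using eigenvalue_lift[OF finite_alphabet closed] unfolding X by blast
    then show "\<exists>c. (\<forall>n. letter_coboundary (A n) (level_subshift A \<tau> n) (c n)) \<and>
       (\<lambda>n. SUP u\<in>language (level_subshift A \<tau> n).
              dist_nearest_int (c n u - \<alpha> * real (height \<tau> n u))) \<longlonglongrightarrow> 0"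
      using coboundaries_of_lift[OF _ _ assms(6)] by blast
  next
    assume "\<exists>c. (\<forall>n. letter_coboundary (A n) (level_subshift A \<tau> n) (c n)) \<and>
       (\<lambda>n. SUP u\<in>language (level_subshift A \<tau> n).
              dist_nearest_int (c n u - \<alpha> * real (height \<tau> n u))) \<longlonglongrightarrow> 0"
    then show "eigenvalue (A 0) X \<alpha>"
      unfolding X using eigenvalue_of_coboundaries[OF closed assms(5)] by blast
  qed
qed

end
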